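(* Suppose that $G$ is hyperbolic relative to a family of subgroups $\mathcal{P}$, and that $H$ is a finitely generated subgroup of $G$. If an orbit map of $H$ into the cusped space $\mathrm{cusp}(G,\mathcal{P})$ is a quasi-isometric embedding, then $H$ is stable in $G$.
   Context: $G$ is a finitely generated group, $\mathcal{P}=\{P_1,\dots,P_n\}$ is a finite family of finitely generated subgroups, and $S$ is a fixed finite generating set of $G$ such that $S\cap P_i$ generates $P_i$ for each $i$. Cusped space (Groves–Manning): the combinatorial horoball on a connected graph $\Gamma$ is the graph with vertex set $\Gamma^{(0)}\times\mathbb{Z}_{\ge0}$, with the edges of $\Gamma$ at level $0$, an edge between $(v,k)$ and $(w,k)$ whenever $k\ge1$ and $0<d_\Gamma(v,w)\le2^k$, and an edge between $(v,k)$ and $(v,k+1)$ for all $v,k$. The cusped space $\mathrm{cusp}(G,\mathcal{P})$ is obtained from the Cayley graph of $G$ with respect to $S$ by attaching, for each $i$ and each left coset $gP_i$, a combinatorial horoball on the copy of the Cayley graph of $P_i$ (with respect to $S\cap P_i$) spanned by $gP_i$, along its level $0$. All edges have length 1. $G$ acts on $\mathrm{cusp}(G,\mathcal{P})$ by isometries. $G$ is hyperbolic relative to $\mathcal{P}$ if and only if $\mathrm{cusp}(G,\mathcal{P})$ is Gromov hyperbolic. For $\kappa\ge 1$, $\lambda\ge 0$, a $(\kappa,\lambda)$-quasi-isometric embedding $\phi\colon X\to Y$ is a map with $\frac1\kappa d_X(a,b)-\lambda\le d_Y(\phi(a),\phi(b))\le \kappa d_X(a,b)+\lambda$ for all $a,b\in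 X$; $H$ carries a word metric. A $\kappa$-quasigeodesic in $Y$ is a $(\kappa,\kappa)$-quasi-isometric embedding of an interval into $Y$. A finitely generated subgroup $H\le G$ is stable in $G$ if (a) the inclusion $H\to G$ is a quasi-isometric embedding for word metrics, and (b) for any $\kappa>1$ there exists $D>0$ such that any two $\kappa$-quasigeodesics in $G$ (in a Cayley graph with respect to a finite generating set) with the same endpoints $a,b\in H$ are $D$-Hausdorff close, i.e. each is contained in the $D$-neighborhood of the other. *)

theory Defs
  imports Complex_Main "HOL-Library.Indicator_Function"
    "HOL-Algebra.Generated_Groups" "HOL-Algebra.Left_Coset"
begin

section \<open>Coarse geometry\<close>

definition qi_embedding_const ::
  "real \<Rightarrow> real \<Rightarrow> 'x set \<Rightarrow> ('x \<Rightarrow> 'x \<Rightarrow> real) \<Rightarrow> 'y set \<Rightarrow> ('y \<Rightarrow> 'y \<Rightarrow> real) \<Rightarrow> ('x \<Rightarrow> 'y) \<Rightarrow> bool"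
  where "qi_embedding_const \<kappa> c X dX Y dY f \<longleftrightarrow>
    1 \<le> \<kappa> \<and> 0 \<le> c \<and> f ` X \<subseteq> Y \<and>
    (\<forall>a\<in>X. \<forall>b\<in>X. (1 / \<kappa>) * dX a b - c \<le> dY (f a) (f b) \<and> dY (f a) (f b) \<le> \<kappa> * dX a b + c)"

definition qi_embedding ::
  "'x set \<Rightarrow> ('x \<Rightarrow> 'x \<Rightarrow> real) \<Rightarrow> 'y set \<Rightarrow> ('y \<Rightarrow> 'y \<Rightarrow> real) \<Rightarrow> ('x \<Rightarrow> 'y) \<Rightarrow> bool"
  where "qi_embedding X dX Y dY f \<longleftrightarrow> (\<exists>\<kappa> c. qi_embedding_const \<kappa> c X dX Y dY f)"

text \<open>Quasigeodesics are not required to be continuous.\<close>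

definition quasigeodesic ::
  "real \<Rightarrow> 'y set \<Rightarrow> ('y \<Rightarrow> 'y \<Rightarrow> real) \<Rightarrow> real \<Rightarrow> real \<Rightarrow> (real \<Rightarrow> 'y) \<Rightarrow> bool"
  where "quasigeodesic \<kappa> Y dY s t \<gamma> \<longleftrightarrow> s \<le> t \<and> qi_embedding_const \<kappa> \<kappa> {s..t} dist Y dY \<gamma>"

definition hausdorff_close :: "real \<Rightarrow> ('y \<Rightarrow> 'y \<Rightarrow> real) \<Rightarrow> 'y set \<Rightarrow> 'y set \<Rightarrow> bool"
  where "hausdorff_close D d A B \<longleftrightarrow>
    (\<forall>x\<in>A. \<exists>y\<in>B. d x y \<le> D) \<and> (\<forall>y\<in>B. \<exists>x\<in>A. d y x \<le> D)"

definition gromov_product :: "('y \<Rightarrow> 'y \<Rightarrow> real) \<Rightarrow> 'y \<Rightarrow> 'y \<Rightarrow> 'y \<Rightarrow> real"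
  where "gromov_product d w x y = (d x w + d y w - d x y) / 2"

definition Gromov_hyperbolic :: "'y set \<Rightarrow> ('y \<Rightarrow> 'y \<Rightarrow> real) \<Rightarrow> bool"
  where "Gromov_hyperbolic Y d \<longleftrightarrow>
    (\<exists>\<delta>\<ge>0. \<forall>w\<in>Y. \<forall>x\<in>Y. \<forall>y\<in>Y. \<forall>z\<in>Y.
      gromov_product d w x z \<ge> min (gromov_product d w x y) (gromov_product d w y z) - \<delta>)"


section \<open>Graphs as metric spaces\<close>

text \<open>Simple graphs; \<open>edges\<close> is meant to be a symmetric and irreflexive relation on \<open>verts\<close>.\<close>

record 'v sgraph =
  verts :: "'v set"
  edges :: "('v \<times> 'v) set"

text \<open>Path metric on the vertices. It is only meaningful for \<open>u\<close>, \<open>v\<close> in the same component.\<close>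

definition gdist :: "'v sgraph \<Rightarrow> 'v \<Rightarrow> 'v \<Rightarrow> nat"
  where "gdist \<Gamma> u v = (LEAST m. (u, v) \<in> edges \<Gamma> ^^ m)"

definition spt :: "('v \<Rightarrow> real) \<Rightarrow> 'v set"
  where "spt p = {x. p x \<noteq> 0}"

text \<open>The geometric realization in barycentric coordinates: a point is a convex combination
  of one vertex or of the two endpoints of an edge. The vertex \<open>v\<close> is the point
  \<open>indicator {v}\<close>.\<close>

definition realization :: "'v sgraph \<Rightarrow> ('v \<Rightarrow> real) set"
  where "realization \<Gamma> =
    {p. (\<forall>x. 0 \<le> p x) \<and>
        (\<exists>u\<in>verts \<Gamma>. \<exists>v\<in>verts \<Gamma>. (u = v \<or> (u, v) \<in> edges \<Gamma>) \<and> spt p \<subseteq> {u, v} \<and> sum p {u, v} = 1)}"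

text \<open>The length metric on the realization, every edge having length 1. Two points of a common
  closed edge are joined by the segment between them; otherwise a shortest path from \<open>p\<close> to \<open>q\<close>
  leaves the edge of \<open>p\<close> through an endpoint \<open>a\<close>, which is at distance \<open>1 - p a\<close> from \<open>p\<close>,
  and enters the edge of \<open>q\<close> through an endpoint \<open>b\<close>.\<close>

definition rdist :: "'v sgraph \<Rightarrow> ('v \<Rightarrow> real) \<Rightarrow> ('v \<Rightarrow> real) \<Rightarrow> real"
  where "rdist \<Gamma> p q =
    (if \<exists>(u, v)\<in>edges \<Gamma>. spt p \<subseteq> {u, v} \<and> spt q \<subseteq> {u, v}
     then (\<Sum>x\<in>spt p \<union> spt q. \<bar>p x - q x\<bar>) / 2
     else Min {(1 - p a) + real (gdist \<Gamma> a b) + (1 - q b) | a b. a \<in> spt p \<and> b \<in> spt q})"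

text \<open>The affine extension of a map of vertices.\<close>

definition realization_map :: "('v \<Rightarrow> 'w) \<Rightarrow> ('v \<Rightarrow> real) \<Rightarrow> 'w \<Rightarrow> real"
  where "realization_map f p = (\<lambda>y. \<Sum>x | x \<in> spt p \<and> f x = y. p x)"

lemma spt_indicator [simp]: "spt (indicator {v}) = {v}"
  by (auto simp: spt_def indicator_def)

lemma realization_map_indicator: "realization_map f (indicator {v}) = indicator {f v}"
proof
  fix y
  have "{x. x \<in> {v} \<and> f x = y} = (if f v = y then {v} else {})"
    by auto
  then show "realization_map f (indicator {v}) y = indicator {f v} y"
    by (auto simp: realization_map_def)
qed

lemma gdist_refl [simp]: "gdist \<Gamma> u u = 0"
  unfolding gdist_def by (rule Least_equality) auto

lemma gdist_edge:
  assumes "(u, v) \<in> edges \<Gamma>" "u \<noteq> v"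
  shows "gdist \<Gamma> u v = 1"
  unfolding gdist_def
proof (rule Least_equality)
  show "(u, v) \<in> edges \<Gamma> ^^ 1" using assms by simp
  show "1 \<le> m" if "(u, v) \<in> edges \<Gamma> ^^ m" for m
    using that assms by (cases m) auto
qed

lemma rdist_vertices:
  assumes "sym (edges \<Gamma>)"
  shows "rdist \<Gamma> (indicator {u}) (indicator {v}) = real (gdist \<Gamma> u v)"
proof (cases "u = v")
  case True
  then show ?thesis
    by (auto simp: rdist_def)
next
  case False
  then have "(\<exists>(x, y)\<in>edges \<Gamma>. u \<in> {x, y} \<and> v \<in> {x, y}) \<longleftrightarrow> (u, v) \<in> edges \<Gamma>"
    using assms by (auto dest: symD)
  with False show ?thesis
    by (auto simp: rdist_def gdist_edge)
qed


section \<open>Groups and cusped spaces\<close>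

definition finitely_generates :: "('a, 'm) monoid_scheme \<Rightarrow> 'a set \<Rightarrow> 'a set \<Rightarrow> bool"
  where "finitely_generates G T H \<longleftrightarrow> finite T \<and> T \<subseteq> carrier G \<and> generate G T = H"

text \<open>The Cayley graph with respect to \<open>T\<close>, on a union \<open>C\<close> of left cosets of the subgroup
  generated by \<open>T\<close>: for \<open>C\<close> this subgroup itself it is its Cayley graph, for \<open>C = g <# H\<close>
  it is the translate of the Cayley graph of \<open>H\<close>. Neither loops nor multiple edges are kept.\<close>

definition cayley_graph :: "('a, 'm) monoid_scheme \<Rightarrow> 'a set \<Rightarrow> 'a set \<Rightarrow> 'a sgraph"
  where "cayley_graph G C T =
    \<lparr>verts = C,
     edges = {(x, y). x \<in> C \<and> y \<in> C \<and> x \<noteq> y \<and> (\<exists>s\<in>T. y = x \<otimes>\<^bsub>G\<^esub> s \<or> x = y \<otimes>\<^bsub>G\<^esub> s)}\<rparr>"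

definition word_metric :: "('a, 'm) monoid_scheme \<Rightarrow> 'a set \<Rightarrow> 'a set \<Rightarrow> 'a \<Rightarrow> 'a \<Rightarrow> real"
  where "word_metric G H T a b = real (gdist (cayley_graph G H T) a b)"

definition horoball :: "'v sgraph \<Rightarrow> ('v \<times> nat) sgraph"
  where "horoball \<Gamma> =
    \<lparr>verts = verts \<Gamma> \<times> UNIV,
     edges =
       {((v, 0), (w, 0)) | v w. (v, w) \<in> edges \<Gamma>} \<union>
       {((v, k), (w, k)) | v w k. v \<in> verts \<Gamma> \<and> w \<in> verts \<Gamma> \<and> 1 \<le> k \<and>
          0 < gdist \<Gamma> v w \<and> gdist \<Gamma> v w \<le> 2 ^ k} \<union>
       {((v, k), (v, Suc k)) | v k. v \<in> verts \<Gamma>} \<union>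
       {((v, Suc k), (v, k)) | v k. v \<in> verts \<Gamma>}\<rparr>"

text \<open>\<open>Deep i g k\<close> with \<open>k \<ge> 1\<close> is the vertex \<open>(g, k)\<close> of the horoball over the coset
  \<open>g <# P i\<close>; the vertices at level \<open>0\<close> are those of the Cayley graph of the group.\<close>

datatype 'a cusp_vertex = Base 'a | Deep nat 'a nat

fun horoball_incl :: "nat \<Rightarrow> 'a \<times> nat \<Rightarrow> 'a cusp_vertex"
  where "horoball_incl i (g, k) = (if k = 0 then Base g else Deep i g k)"

definition coset_horoball ::
  "('a, 'm) monoid_scheme \<Rightarrow> 'a set \<Rightarrow> 'a set \<Rightarrow> 'a set \<Rightarrow> ('a \<times> nat) sgraph"
  where "coset_horoball G S P C = horoball (cayley_graph G C (S \<inter> P))"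

definition cusp ::
  "('a, 'm) monoid_scheme \<Rightarrow> 'a set \<Rightarrow> nat \<Rightarrow> (nat \<Rightarrow> 'a set) \<Rightarrow> 'a cusp_vertex sgraph"
  where "cusp G S n P =
    \<lparr>verts = Base ` carrier G \<union>
       (\<Union>i\<in>{1..n}. \<Union>C\<in>lcosets\<^bsub>G\<^esub> (P i). horoball_incl i ` verts (coset_horoball G S (P i) C)),
     edges = map_prod Base Base ` edges (cayley_graph G (carrier G) S) \<union>
       (\<Union>i\<in>{1..n}. \<Union>C\<in>lcosets\<^bsub>G\<^esub> (P i).
          map_prod (horoball_incl i) (horoball_incl i) ` edges (coset_horoball G S (P i) C))\<rparr>"

fun cusp_act :: "('a, 'm) monoid_scheme \<Rightarrow> 'a \<Rightarrow> 'a cusp_vertex \<Rightarrow> 'a cusp_vertex"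
  where
    "cusp_act G h (Base g) = Base (h \<otimes>\<^bsub>G\<^esub> g)"
  | "cusp_act G h (Deep i g k) = Deep i (h \<otimes>\<^bsub>G\<^esub> g) k"

definition orbit_map ::
  "('a, 'm) monoid_scheme \<Rightarrow> ('a cusp_vertex \<Rightarrow> real) \<Rightarrow> 'a \<Rightarrow> 'a cusp_vertex \<Rightarrow> real"
  where "orbit_map G x0 h = realization_map (cusp_act G h) x0"

definition relatively_hyperbolic ::
  "('a, 'm) monoid_scheme \<Rightarrow> 'a set \<Rightarrow> nat \<Rightarrow> (nat \<Rightarrow> 'a set) \<Rightarrow> bool"
  where "relatively_hyperbolic G S n P \<longleftrightarrow>
    Gromov_hyperbolic (realization (cusp G S n P)) (rdist (cusp G S n P))"


section \<open>Stable subgroups\<close>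

text \<open>Stability does not depend on the finite generating sets \<open>T\<close> of \<open>H\<close> and \<open>A\<close> of \<open>G\<close>;
  here it is required for all of them.\<close>

definition stable_subgroup :: "('a, 'm) monoid_scheme \<Rightarrow> 'a set \<Rightarrow> bool"
  where "stable_subgroup G H \<longleftrightarrow>
    subgroup H G \<and>
    (\<exists>T. finitely_generates G T H) \<and>
    (\<exists>A. finitely_generates G A (carrier G)) \<and>
    (\<forall>T A. finitely_generates G T H \<longrightarrow> finitely_generates G A (carrier G) \<longrightarrow>
      qi_embedding H (word_metric G H T) (carrier G) (word_metric G (carrier G) A) (\<lambda>h. h)) \<and>
    (\<forall>A. finitely_generates G A (carrier G) \<longrightarrow>
      (let \<Gamma> = cayley_graph G (carrier G) A; Y = realization \<Gamma>; d = rdist \<Gamma> in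
       \<forall>\<kappa>>1. \<exists>D>0. \<forall>a\<in>H. \<forall>b\<in>H. \<forall>\<gamma> s t \<gamma>' s' t'.
         quasigeodesic \<kappa> Y d s t \<gamma> \<longrightarrow> \<gamma> s = indicator {a} \<longrightarrow> \<gamma> t = indicator {b} \<longrightarrow>
         quasigeodesic \<kappa> Y d s' t' \<gamma>' \<longrightarrow> \<gamma>' s' = indicator {a} \<longrightarrow> \<gamma>' t' = indicator {b} \<longrightarrow>
         hausdorff_close D d (\<gamma> ` {s..t}) (\<gamma>' ` {s'..t'})))"

end

theory Submission
  imports Defs
begin

text \<open>
  Let \<open>a, b\<close> be points of \<open>H\<close> and let \<open>\<alpha>\<close> be a geodesic of \<open>H\<close> from \<open>a\<close> to \<open>b\<close>. By assumption \<open>\<alpha>\<close> is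
  a quasigeodesic of the hyperbolic cusped space \<open>X\<close>, hence quasiconvex there, and
  nearest-point projection to \<open>\<alpha>\<close> (for the metric of \<open>X\<close>) is contracting: a set of diameter less
  than about twice its distance to \<open>\<alpha>\<close> projects to a set of bounded diameter.
  Consider an excursion of a quasigeodesic \<open>\<gamma>\<close> of \<open>G\<close> to the outside of the
  \<open>r\<close>-neighbourhood of \<open>\<alpha>\<close> in \<open>X\<close>. A long excursion makes its projection move more slowly than the
  parameter, by a factor as small as we like if \<open>r\<close> is large. On the other hand two elements of \<open>G\<close> at
  distance \<open>k\<close> in \<open>X\<close> have distance at most \<open>k * 2 ^ k\<close> in \<open>G\<close>, so the ends of the excursion are within
  a constant \<open>F r\<close> of their projections in \<open>G\<close>, and the \<open>G\<close>-distance of these projections bounds the length of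
  the excursion because \<open>\<gamma>\<close> is a quasigeodesic of \<open>G\<close>. So excursions have
  bounded length, and \<open>\<gamma>\<close> stays in a bounded neighbourhood of \<open>\<alpha>\<close>, in \<open>X\<close> and therefore in \<open>G\<close>.
  By connectedness \<open>\<alpha>\<close> also stays close to every such \<open>\<gamma>\<close>.
\<close>

section \<open>Connected graphs\<close>

locale connected_graph =
  fixes \<Gamma> :: "'v sgraph"
  assumes sym_edges: "sym (edges \<Gamma>)"
    and edges_verts: "edges \<Gamma> \<subseteq> verts \<Gamma> \<times> verts \<Gamma>"
    and connected: "u \<in> verts \<Gamma> \<Longrightarrow> v \<in> verts \<Gamma> \<Longrightarrow> \<exists>m. (u, v) \<in> edges \<Gamma> ^^ m"
begin

abbreviation d where "d \<equiv> gdist \<Gamma>"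

lemma gdist_relpow: "u \<in> verts \<Gamma> \<Longrightarrow> v \<in> verts \<Gamma> \<Longrightarrow> (u, v) \<in> edges \<Gamma> ^^ d u v"
  unfolding gdist_def by (rule LeastI_ex[OF connected])

lemma gdist_le: "(u, v) \<in> edges \<Gamma> ^^ m \<Longrightarrow> d u v \<le> m"
  unfolding gdist_def by (rule Least_le)

lemma relpow_sym: "(u, v) \<in> edges \<Gamma> ^^ m \<Longrightarrow> (v, u) \<in> edges \<Gamma> ^^ m"
proof (induction m arbitrary: v)
  case (Suc m)
  then obtain w where w: "(u, w) \<in> edges \<Gamma> ^^ m" "(w, v) \<in> edges \<Gamma>" by (elim relpow_Suc_E)
  show ?case using relpow_Suc_I2[OF symD[OF sym_edges w(2)] Suc.IH[OF w(1)]] .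
qed simp

lemma gdist_sym: "u \<in> verts \<Gamma> \<Longrightarrow> v \<in> verts \<Gamma> \<Longrightarrow> d u v = d v u"
  by (meson antisym gdist_le gdist_relpow relpow_sym)

lemma gdist_triangle:
  assumes "u \<in> verts \<Gamma>" "v \<in> verts \<Gamma>" "w \<in> verts \<Gamma>"
  shows "d u w \<le> d u v + d v w"
proof (rule gdist_le)
  show "(u, w) \<in> edges \<Gamma> ^^ (d u v + d v w)"
    unfolding relpow_add using gdist_relpow assms by blast
qed

lemma gdist_triangle4:
  assumes "u \<in> verts \<Gamma>" "v \<in> verts \<Gamma>" "w \<in> verts \<Gamma>" "x \<in> verts \<Gamma>"
  shows "d u x \<le> d u v + d v w + d w x"
  using gdist_triangle[of u v x] gdist_triangle[of v w x] assms by simp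

definition geodesic :: "(nat \<Rightarrow> 'v) \<Rightarrow> nat \<Rightarrow> bool"
  where "geodesic f N \<longleftrightarrow> (\<forall>i\<le>N. f i \<in> verts \<Gamma>) \<and> (\<forall>i j. i \<le> j \<longrightarrow> j \<le> N \<longrightarrow> d (f i) (f j) = j - i)"

lemma geodesic_exists:
  assumes "u \<in> verts \<Gamma>" "v \<in> verts \<Gamma>"
  obtains f where "geodesic f (d u v)" "f 0 = u" "f (d u v) = v"
proof -
  obtain f where f: "f 0 = u" "f (d u v) = v" "\<And>i. i < d u v \<Longrightarrow> (f i, f (Suc i)) \<in> edges \<Gamma>"
    using gdist_relpow[OF assms] unfolding relpow_fun_conv by blast
  have verts: "f i \<in> verts \<Gamma>" if "i \<le> d u v" for i
    using f(3)[of i] f(2) edges_verts assms(2) that by (cases "i = d u v") auto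
  have le: "d (f i) (f j) \<le> j - i" if "i \<le> j" "j \<le> d u v" for i j
  proof (rule gdist_le)
    show "(f i, f j) \<in> edges \<Gamma> ^^ (j - i)"
      unfolding relpow_fun_conv using that
      by (intro exI[of _ "\<lambda>k. f (i + k)"]) (auto intro!: f(3))
  qed
  \<comment> \<open>The three pieces have lengths at most \<open>i\<close>, \<open>j - i\<close> and
    \<open>d u v - j\<close> and together at least \<open>d u v\<close>, so none of them can be
    shorter.\<close>
  have "d (f i) (f j) = j - i" if "i \<le> j" "j \<le> d u v" for i j
    using le[OF that] le[of 0 i] le[of j "d u v"] that
      gdist_triangle4[of "f 0" "f i" "f j" "f (d u v)"] verts[of 0] verts[of i] verts[of j]
      verts[of "d u v"] f(1,2) by simp
  with f verts show thesis using that unfolding geodesic_def by blast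
qed

section \<open>Points of the realization and the vertices supporting them\<close>

lemma realization_spt:
  assumes "p \<in> realization \<Gamma>"
  shows "finite (spt p)" "spt p \<noteq> {}" "spt p \<subseteq> verts \<Gamma>" "\<And>x. 0 \<le> p x" "\<And>x. p x \<le> 1"
    "\<And>a b. a \<in> spt p \<Longrightarrow> b \<in> spt p \<Longrightarrow> d a b \<le> 1"
proof -
  note p = assms[unfolded realization_def mem_Collect_eq]
  have nn: "\<And>x. 0 \<le> p x" using conjunct1[OF p] ..
  from conjunct2[OF p] obtain u v where uv: "u \<in> verts \<Gamma>" "v \<in> verts \<Gamma>" "u = v \<or> (u, v) \<in> edges \<Gamma>"
    "spt p \<subseteq> {u, v}" "sum p {u, v} = 1" by (elim bexE conjE)
  show "finite (spt p)" using uv(4) finite_subset by blast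
  show "spt p \<subseteq> verts \<Gamma>" using uv by blast
  show "0 \<le> p x" for x by (rule nn)
  show "spt p \<noteq> {}"
  proof
    assume "spt p = {}"
    then have "p x = 0" for x unfolding spt_def by blast
    then have "sum p {u, v} = 0" by (intro sum.neutral) blast
    with uv(5) show False by simp
  qed
  show "p x \<le> 1" for x
  proof (cases "x \<in> {u, v}")
    case True
    then have "p x \<le> sum p {u, v}" by (intro member_le_sum nn) auto
    then show ?thesis using uv(5) by simp
  next
    case False
    then have "p x = 0" using uv(4) by (auto simp: spt_def)
    then show ?thesis by simp
  qed
  show "d a b \<le> 1" if "a \<in> spt p" "b \<in> spt p" for a b
  proof (cases "a = b")
    case False
    then have "(a, b) \<in> edges \<Gamma>" using that uv sym_edges by (blast dest: symD)
    then show ?thesis using gdist_le[of a b 1] by simp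
  qed simp
qed

text \<open>Lets all later arguments run on vertices: rounding a point to any vertex of its support
  moves it by at most 1, and both points are rounded.\<close>

lemma rdist_gdist:
  assumes p: "p \<in> realization \<Gamma>" and q: "q \<in> realization \<Gamma>" and a: "a \<in> spt p" and b: "b \<in> spt q"
  shows "\<bar>rdist \<Gamma> p q - real (d a b)\<bar> \<le> 2"
proof (cases "\<exists>(u, v)\<in>edges \<Gamma>. spt p \<subseteq> {u, v} \<and> spt q \<subseteq> {u, v}")
  case True
  then obtain u v where uv: "(u, v) \<in> edges \<Gamma>" "spt p \<subseteq> {u, v}" "spt q \<subseteq> {u, v}" by blast
  have "a = b \<or> (a, b) \<in> edges \<Gamma>" using a b uv sym_edges by (auto dest: symD)
  then have "d a b \<le> 1" using gdist_le[of a b 1] by auto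
  moreover have "(\<Sum>x\<in>spt p \<union> spt q. \<bar>p x - q x\<bar>) \<le> (\<Sum>x\<in>{u, v}. \<bar>p x - q x\<bar>)"
    using uv by (intro sum_mono2) auto
  moreover have "(\<Sum>x\<in>{u, v}. \<bar>p x - q x\<bar>) \<le> (\<Sum>x\<in>{u, v}. 1)"
    using realization_spt(4,5)[OF p] realization_spt(4,5)[OF q]
    by (intro sum_mono) (smt (verit))
  moreover have "(\<Sum>x\<in>{u, v}. 1::real) \<le> 2" by (cases "u = v") auto
  moreover have "0 \<le> (\<Sum>x\<in>spt p \<union> spt q. \<bar>p x - q x\<bar>)" by (intro sum_nonneg) auto
  moreover have "rdist \<Gamma> p q = (\<Sum>x\<in>spt p \<union> spt q. \<bar>p x - q x\<bar>) / 2"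
    using True by (simp add: rdist_def)
  ultimately show ?thesis by linarith
next
  case False
  let ?M = "{(1 - p a) + real (d a b) + (1 - q b) | a b. a \<in> spt p \<and> b \<in> spt q}"
  have r: "rdist \<Gamma> p q = Min ?M" using False by (auto simp: rdist_def)
  have "?M = (\<lambda>(a, b). (1 - p a) + real (d a b) + (1 - q b)) ` (spt p \<times> spt q)" by auto
  then have fin: "finite ?M" using realization_spt(1) p q by simp
  have ne: "?M \<noteq> {}" using a b by auto
  have "Min ?M \<le> (1 - p a) + real (d a b) + (1 - q b)"
    by (rule Min_le[OF fin]) (use a b in auto)
  then have up: "rdist \<Gamma> p q \<le> real (d a b) + 2"
    using r realization_spt(4)[OF p, of a] realization_spt(4)[OF q, of b] by linarith
  have "Min ?M \<in> ?M" by (rule Min_in[OF fin ne])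
  then obtain a' b' where ab: "a' \<in> spt p" "b' \<in> spt q"
    "rdist \<Gamma> p q = (1 - p a') + real (d a' b') + (1 - q b')" using r by auto
  \<comment> \<open>The minimum may be attained at other endpoints than \<open>a\<close> and
    \<open>b\<close>; changing an endpoint costs at most 1 on each side.\<close>
  have "d a b \<le> d a a' + d a' b' + d b' b"
    using a b ab realization_spt(3)[OF p] realization_spt(3)[OF q] by (intro gdist_triangle4) auto
  moreover have "d a a' \<le> 1" "d b' b \<le> 1" using realization_spt(6) p q a b ab by auto
  ultimately have "real (d a b) \<le> real (d a' b') + 2" by linarith
  then show ?thesis
    using up ab realization_spt(5)[OF p, of a'] realization_spt(5)[OF q, of b'] by linarith
qed

lemma indicator_realization: "v \<in> verts \<Gamma> \<Longrightarrow> indicator {v} \<in> realization \<Gamma>"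
  unfolding realization_def by (auto intro!: bexI[of _ v])

end

section \<open>Quasigeodesic sequences\<close>

text \<open>Integer times allow induction on the number of steps, and multiplying out the lower
  bound avoids division. The distance is an argument because the same sequence is measured in a
  Cayley graph and in the cusped space.\<close>

definition quasi_chain :: "real \<Rightarrow> ('x \<Rightarrow> 'x \<Rightarrow> nat) \<Rightarrow> nat \<Rightarrow> (nat \<Rightarrow> 'x) \<Rightarrow> bool"
  where "quasi_chain K d m h \<longleftrightarrow> (\<forall>i\<le>m. \<forall>j\<le>m.
    \<bar>real i - real j\<bar> \<le> K * real (d (h i) (h j)) + K \<and>
    real (d (h i) (h j)) \<le> K * \<bar>real i - real j\<bar> + K)"

lemma quasi_chain_shift:
  assumes "quasi_chain K d m h" "i \<le> j" "j \<le> m"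
  shows "quasi_chain K d (j - i) (\<lambda>l. h (i + l))"
  unfolding quasi_chain_def
proof (intro allI impI)
  fix a b assume "a \<le> j - i" "b \<le> j - i"
  then have "i + a \<le> m" "i + b \<le> m" using assms(2,3) by auto
  moreover have "real (i + a) - real (i + b) = real a - real b" by simp
  ultimately show "\<bar>real a - real b\<bar> \<le> K * real (d (h (i + a)) (h (i + b))) + K \<and>
      real (d (h (i + a)) (h (i + b))) \<le> K * \<bar>real a - real b\<bar> + K"
    using assms(1) unfolding quasi_chain_def by metis
qed

lemma quasi_chain_rev_shift:
  assumes "quasi_chain K d m h" "j \<le> i" "i \<le> m"
  shows "quasi_chain K d (i - j) (\<lambda>l. h (i - l))"
  unfolding quasi_chain_def
proof (intro allI impI)
  fix a b assume ab: "a \<le> i - j" "b \<le> i - j"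
  then have "i - a \<le> m" "i - b \<le> m" using assms(2,3) by auto
  moreover have "\<bar>real (i - a) - real (i - b)\<bar> = \<bar>real a - real b\<bar>" using ab by linarith
  ultimately show "\<bar>real a - real b\<bar> \<le> K * real (d (h (i - a)) (h (i - b))) + K \<and>
      real (d (h (i - a)) (h (i - b))) \<le> K * \<bar>real a - real b\<bar> + K"
    using assms(1) unfolding quasi_chain_def by metis
qed

lemma quasi_chain_mono:
  assumes "quasi_chain K d m h" "K \<le> K'"
  shows "quasi_chain K' d m h"
  unfolding quasi_chain_def
proof (intro allI impI)
  fix i j assume "i \<le> m" "j \<le> m"
  then have "\<bar>real i - real j\<bar> \<le> K * real (d (h i) (h j)) + K"
    "real (d (h i) (h j)) \<le> K * \<bar>real i - real j\<bar> + K"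
    using assms(1) unfolding quasi_chain_def by blast+
  moreover have "K * real (d (h i) (h j)) \<le> K' * real (d (h i) (h j))"
    "K * \<bar>real i - real j\<bar> \<le> K' * \<bar>real i - real j\<bar>"
    using assms(2) by (auto intro: mult_right_mono)
  ultimately show "\<bar>real i - real j\<bar> \<le> K' * real (d (h i) (h j)) + K' \<and>
      real (d (h i) (h j)) \<le> K' * \<bar>real i - real j\<bar> + K'"
    using assms(2) by linarith
qed

context connected_graph
begin

text \<open>Applied to a geodesic of \<open>H\<close>, with \<open>\<phi>\<close> its inclusion into
  the group or into the cusped space.\<close>

lemma quasi_chain_geodesic:
  assumes f: "geodesic f N" and K: "\<And>x y. \<lbrakk>x \<in> verts \<Gamma>; y \<in> verts \<Gamma>\<rbrakk> \<Longrightarrow>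
      real (d x y) \<le> K * real (e (\<phi> x) (\<phi> y)) + K \<and> real (e (\<phi> x) (\<phi> y)) \<le> K * real (d x y) + K"
  shows "quasi_chain K e N (\<lambda>i. \<phi> (f i))"
  unfolding quasi_chain_def
proof (intro allI impI)
  fix i j assume ij: "i \<le> N" "j \<le> N"
  then have V: "f i \<in> verts \<Gamma>" "f j \<in> verts \<Gamma>" using f unfolding geodesic_def by auto
  have "real (d (f i) (f j)) = \<bar>real i - real j\<bar>"
  proof (cases "i \<le> j")
    case True
    then show ?thesis using f ij unfolding geodesic_def by simp
  next
    case False
    then show ?thesis using f ij gdist_sym[OF V] unfolding geodesic_def by (simp add: of_nat_diff)
  qed
  then show "\<bar>real i - real j\<bar> \<le> K * real (e (\<phi> (f i)) (\<phi> (f j))) + K \<and>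
      real (e (\<phi> (f i)) (\<phi> (f j))) \<le> K * \<bar>real i - real j\<bar> + K"
    using K[OF V] by simp
qed

end

section \<open>Hyperbolic graphs\<close>

text \<open>Turns the logarithmic estimate for a detour into an absolute bound. It follows from
  \<open>k * k \<le> 2 ^ k\<close> for \<open>k \<ge> 4\<close>.\<close>

lemma linear_le_two_power: "\<exists>k0. \<forall>k\<ge>k0. a * real k + b \<le> 2 ^ k"
proof (intro exI allI impI)
  fix k assume "max 4 (nat \<lceil>\<bar>a\<bar> + \<bar>b\<bar>\<rceil>) \<le> k"
  then have k: "4 \<le> k" "\<bar>a\<bar> + \<bar>b\<bar> \<le> real k" by linarith+
  have square: "k * k \<le> 2 ^ k" using k(1)
  proof (induction k rule: dec_induct)
    case (step k)
    have "4 * k \<le> k * k" using step by simp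
    then have "2 * k + 1 \<le> k * k" using step by linarith
    then show ?case using step by simp
  qed simp
  have "a * real k \<le> \<bar>a\<bar> * real k" by (intro mult_right_mono) auto
  moreover have "b \<le> \<bar>b\<bar> * real k"
    using mult_left_mono[of 1 "real k" "\<bar>b\<bar>"] k by linarith
  ultimately have "a * real k + b \<le> (\<bar>a\<bar> + \<bar>b\<bar>) * real k" by (simp add: algebra_simps)
  also have "\<dots> \<le> real k * real k" using k by (intro mult_right_mono) auto
  also have "\<dots> = real (k * k)" by simp
  also have "\<dots> \<le> 2 ^ k" using square by (metis of_nat_le_iff of_nat_numeral of_nat_power)
  finally show "a * real k + b \<le> 2 ^ k" .
qed

lemma gromov_product_commute:
  "d x y = d y x \<Longrightarrow> gromov_product d w x y = gromov_product d w y x"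
  by (simp add: gromov_product_def)

locale hyperbolic_graph = connected_graph \<Gamma> for \<Gamma> :: "'v sgraph" +
  fixes \<delta> :: real
  assumes \<delta>_nonneg: "0 \<le> \<delta>"
    and hyperbolic: "\<lbrakk>w \<in> verts \<Gamma>; x \<in> verts \<Gamma>; y \<in> verts \<Gamma>; z \<in> verts \<Gamma>\<rbrakk> \<Longrightarrow>
      min (gromov_product (gdist \<Gamma>) w x y) (gromov_product (gdist \<Gamma>) w y z) - \<delta>
        \<le> gromov_product (gdist \<Gamma>) w x z"
begin

abbreviation gp where "gp \<equiv> gromov_product (gdist \<Gamma>)"

text \<open>Neighbouring points at distance at least \<open>r\<close> from \<open>w\<close> have
  product at least \<open>r - c / 2\<close>. Halving the chain costs one \<open>\<delta>\<close> per
  level, so \<open>2 ^ k\<close> steps lose only \<open>k * \<delta>\<close>.\<close>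

lemma gp_chain:
  assumes "w \<in> verts \<Gamma>" "\<And>i. i \<le> n \<Longrightarrow> x i \<in> verts \<Gamma>"
    and "\<And>i. i \<le> n \<Longrightarrow> r \<le> real (d (x i) w)" "\<And>i. i < n \<Longrightarrow> real (d (x i) (x (Suc i))) \<le> c"
    and "0 \<le> c" "n \<le> 2 ^ k"
  shows "r - c / 2 - real k * \<delta> \<le> gp w (x 0) (x n)"
  using assms(2-)
proof (induction k arbitrary: n x)
  case 0
  then consider "n = 0" | "n = 1" by fastforce
  then show ?case
  proof cases
    case 1
    then show ?thesis using 0(2)[of 0] \<open>0 \<le> c\<close> by (simp add: gromov_product_def)
  next
    case 2
    then show ?thesis using 0(2)[of 0] 0(2)[of 1] 0(3)[of 0] by (simp add: gromov_product_def)
  qed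
next
  case (Suc k)
  define m where "m = n div 2"
  have m: "m \<le> n" "m \<le> 2 ^ k" "n - m \<le> 2 ^ k" using Suc.prems(5) by (auto simp: m_def)
  have 1: "r - c / 2 - real k * \<delta> \<le> gp w (x 0) (x m)"
    using Suc.prems m by (intro Suc.IH) auto
  have "r - c / 2 - real k * \<delta> \<le> gp w (x (m + 0)) (x (m + (n - m)))"
    using Suc.prems m by (intro Suc.IH) auto
  with 1 have "r - c / 2 - real k * \<delta> \<le> min (gp w (x 0) (x m)) (gp w (x m) (x n))"
    using m by simp
  then have "r - c / 2 - real k * \<delta> - \<delta> \<le> gp w (x 0) (x n)"
    using hyperbolic[OF assms(1), of "x 0" "x m" "x n"] Suc.prems(1) m by fastforce
  then show ?case by (simp add: algebra_simps)
qed

text \<open>Consecutive points of the chain are at most \<open>2 * K\<close> apart, so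
  \<open>gp_chain\<close> applies with \<open>c = 2 * K\<close>; for \<open>p > q\<close> the chain
  is read backwards.\<close>

lemma gp_quasi_chain:
  assumes "quasi_chain K d m h" "\<And>i. i \<le> m \<Longrightarrow> h i \<in> verts \<Gamma>" "w \<in> verts \<Gamma>" "0 \<le> K"
    and r: "\<And>i. i \<le> m \<Longrightarrow> r \<le> real (d (h i) w)"
    and pq: "p \<le> m" "q \<le> m" "\<bar>real p - real q\<bar> \<le> 2 ^ k"
  shows "r - K - real k * \<delta> \<le> gp w (h p) (h q)"
proof -
  have step: "real (d (h i) (h j)) \<le> 2 * K" if "i \<le> m" "j \<le> m" "\<bar>real i - real j\<bar> = 1" for i j
    using assms(1) that unfolding quasi_chain_def by fastforce
  show ?thesis
  proof (cases "p \<le> q")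
    case True
    then have "real (q - p) \<le> 2 ^ k" using pq by (simp add: of_nat_diff)
    then have "q - p \<le> 2 ^ k" by (metis of_nat_le_iff of_nat_numeral of_nat_power)
    then have "r - 2 * K / 2 - real k * \<delta> \<le> gp w (h (p + 0)) (h (p + (q - p)))"
      using assms(2-4) r pq by (intro gp_chain step) auto
    then show ?thesis using True by simp
  next
    case False
    then have "real (p - q) \<le> 2 ^ k" using pq by (simp add: of_nat_diff)
    then have "p - q \<le> 2 ^ k" by (metis of_nat_le_iff of_nat_numeral of_nat_power)
    then have "r - 2 * K / 2 - real k * \<delta> \<le> gp w (h (p - 0)) (h (p - (p - q)))"
      using assms(2-4) r pq by (intro gp_chain[where x = "\<lambda>i. h (p - i)"] step) (auto simp: of_nat_diff)
    then show ?thesis using False by simp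
  qed
qed

text \<open>Around the point \<open>f t0\<close> of the geodesic at distance \<open>D\<close> from \<open>h\<close> there is a detour along \<open>h\<close>
  whose length is linear in \<open>D\<close> and which avoids the ball of radius \<open>D\<close>. The hyperbolic inequality,
  iterated logarithmically often along the detour, bounds \<open>D\<close>.\<close>

lemma geodesic_excursion:
  assumes f: "geodesic f N" "f 0 = h 0" "f N = h m"
    and h: "quasi_chain K d m h" "\<And>i. i \<le> m \<Longrightarrow> h i \<in> verts \<Gamma>" and K: "1 \<le> K"
    and near: "\<And>t. t \<le> N \<Longrightarrow> \<exists>j\<le>m. d (f t) (h j) \<le> D"
    and far: "t0 \<le> N" "\<And>j. j \<le> m \<Longrightarrow> D \<le> d (f t0) (h j)"
    and k: "6 * K * real D + K \<le> 2 ^ k"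
  shows "real D \<le> K + 2 * \<delta> + real k * \<delta>"
proof -
  \<comment> \<open>The points \<open>2 * D\<close> before and after \<open>w\<close> on the
    geodesic, cut off at its ends; natural subtraction does this at 0.\<close>
  define w a b where "w = f t0" and "a = t0 - 2 * D" and "b = min N (t0 + 2 * D)"
  have ab: "a \<le> t0" "t0 \<le> b" "b \<le> N" "t0 - a \<le> 2 * D" "b - t0 \<le> 2 * D"
    using far(1) by (auto simp: a_def b_def)
  have V: "f i \<in> verts \<Gamma>" if "i \<le> N" for i using f(1) that unfolding geodesic_def by blast
  have df: "d (f i) (f j) = j - i" if "i \<le> j" "j \<le> N" for i j
    using f(1) that unfolding geodesic_def by blast
  have w: "w \<in> verts \<Gamma>" "f a \<in> verts \<Gamma>" "f b \<in> verts \<Gamma>" using V ab far(1) by (auto simp: w_def)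
  have far': "D \<le> d (h j) w" if "j \<le> m" for j
    using far(2)[OF that] gdist_sym[OF w(1) h(2)[OF that]] by (simp add: w_def)
  \<comment> \<open>If \<open>a\<close> was cut off, \<open>f a\<close> is the point
    \<open>h 0\<close> itself, at distance at least \<open>D\<close> from \<open>w\<close>.
    Otherwise \<open>f a\<close> is \<open>2 * D\<close> from \<open>w\<close>, and the product with
    a point \<open>h p\<close> within \<open>D\<close> is at least
    \<open>(2 * D + D - D) / 2\<close>.\<close>
  have "\<exists>p\<le>m. d (f a) (h p) \<le> D \<and> real D \<le> gp w (f a) (h p)"
  proof (cases "t0 < 2 * D")
    case True
    then have "f a = h 0" using f(2) by (simp add: a_def)
    then show ?thesis using far'[of 0] by (intro exI[of _ 0]) (simp add: gromov_product_def)
  next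
    case False
    obtain p where p: "p \<le> m" "d (f a) (h p) \<le> D" using near[of a] ab by auto
    have "d (f a) w = 2 * D" using df[of a t0] False ab far(1) by (simp add: w_def a_def)
    then show ?thesis using p far'[OF p(1)] by (intro exI[of _ p]) (simp add: gromov_product_def)
  qed
  then obtain p where p: "p \<le> m" "d (f a) (h p) \<le> D" "real D \<le> gp w (f a) (h p)" by blast
  have "\<exists>q\<le>m. d (f b) (h q) \<le> D \<and> real D \<le> gp w (f b) (h q)"
  proof (cases "N < t0 + 2 * D")
    case True
    then have "f b = h m" using f(3) by (simp add: b_def)
    then show ?thesis using far'[of m] by (intro exI[of _ m]) (simp add: gromov_product_def)
  next
    case False
    obtain p where p: "p \<le> m" "d (f b) (h p) \<le> D" using near[of b] ab by auto
    have "d (f b) w = 2 * D"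
      using df[of t0 b] False ab far(1) gdist_sym[OF w(1,3)] by (simp add: w_def b_def)
    then show ?thesis using p far'[OF p(1)] by (intro exI[of _ p]) (simp add: gromov_product_def)
  qed
  then obtain q where q: "q \<le> m" "d (f b) (h q) \<le> D" "real D \<le> gp w (f b) (h q)" by blast
  have hpq: "h p \<in> verts \<Gamma>" "h q \<in> verts \<Gamma>" using h(2) p q by auto
  have dab: "d (f a) (f b) = b - a" "d (f a) w = t0 - a" "d (f b) w = b - t0"
    using df[of a b] df[of a t0] df[of t0 b] ab far(1) gdist_sym[OF w(1,3)] by (auto simp: w_def)
  \<comment> \<open>At most \<open>D\<close> to reach the geodesic, \<open>4 * D\<close> along it
    and \<open>D\<close> back.\<close>
  have "d (h p) (h q) \<le> 6 * D"
    using gdist_triangle4[OF hpq(1) w(2) w(3) hpq(2)] gdist_sym[OF hpq(1) w(2)] p q dab ab by linarith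
  then have "K * real (d (h p) (h q)) \<le> K * (6 * real D)" using K by (intro mult_left_mono) auto
  moreover have "\<bar>real p - real q\<bar> \<le> K * real (d (h p) (h q)) + K"
    using h(1) p(1) q(1) unfolding quasi_chain_def by blast
  ultimately have "\<bar>real p - real q\<bar> \<le> 2 ^ k" using k by linarith
  then have pq: "real D - K - real k * \<delta> \<le> gp w (h p) (h q)"
    using h w(1) K far' p q by (intro gp_quasi_chain) auto
  \<comment> \<open>The point \<open>w\<close> lies on the geodesic between \<open>f a\<close> and
    \<open>f b\<close>, while two uses of hyperbolicity along \<open>f a\<close>,
    \<open>h p\<close>, \<open>h q\<close>, \<open>f b\<close> bound the same product below by
    \<open>D - K - k * \<delta> - 2 * \<delta>\<close>.\<close>
  have "gp w (f a) (f b) = 0"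
    using dab ab by (simp add: gromov_product_def of_nat_diff)
  moreover have "gp w (h q) (f b) = gp w (f b) (h q)"
    using gdist_sym[OF hpq(2) w(3)] by (intro gromov_product_commute) simp
  moreover have "0 \<le> real k * \<delta>" using \<delta>_nonneg by simp
  ultimately show ?thesis
    using hyperbolic[OF w(1,2) hpq(1,2)] hyperbolic[OF w(1,2) hpq(2) w(3)] pq p(3) q(3) K \<delta>_nonneg
    by linarith
qed

text \<open>The least radius \<open>D\<close> of a neighbourhood of \<open>h\<close> containing the
  geodesic satisfies the excursion bound, so it is at most linear in the least \<open>k\<close> with
  \<open>6 * K * D + K \<le> 2 ^ k\<close>. This forces \<open>k \<le> k0\<close>.\<close>

lemma geodesic_near_quasi_chain:
  assumes K: "1 \<le> K"
  obtains D where "\<And>f N h m t. \<lbrakk>geodesic f N; f 0 = h 0; f N = h m; quasi_chain K d m h;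
    \<And>i. i \<le> m \<Longrightarrow> h i \<in> verts \<Gamma>; t \<le> N\<rbrakk> \<Longrightarrow> \<exists>j\<le>m. real (d (f t) (h j)) \<le> D"
proof -
  \<comment> \<open>The left side is \<open>6 * K * D + K\<close> after inserting the excursion
    bound for \<open>D\<close> with exponent \<open>k + 1\<close>.\<close>
  obtain k0 where k0: "\<And>k. k \<ge> k0 \<Longrightarrow> 6 * K * \<delta> * real k + (6 * K * (K + 3 * \<delta>) + K) \<le> 2 ^ k"
    using linear_le_two_power by blast
  define D0 where "D0 = K + 2 * \<delta> + real k0 * \<delta>"
  have "\<exists>j\<le>m. real (d (f t) (h j)) \<le> D0"
    if f: "geodesic f N" "f 0 = h 0" "f N = h m"
      and h: "quasi_chain K d m h" "\<And>i. i \<le> m \<Longrightarrow> h i \<in> verts \<Gamma>" and t: "t \<le> N"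
    for f N h m t
  proof -
    define Q where "Q = (\<lambda>D. \<forall>t\<le>N. \<exists>j\<le>m. d (f t) (h j) \<le> D)"
    \<comment> \<open>The common starting point gives the crude radius \<open>N\<close>, so a least
      radius exists.\<close>
    have "Q N" unfolding Q_def
    proof (intro allI impI)
      fix t assume "t \<le> N"
      then have "d (f 0) (f t) = t" "f 0 \<in> verts \<Gamma>" "f t \<in> verts \<Gamma>"
        using f(1) unfolding geodesic_def by auto
      then show "\<exists>j\<le>m. d (f t) (h j) \<le> N"
        using \<open>t \<le> N\<close> f(2) gdist_sym[of "f 0" "f t"] by (intro exI[of _ 0]) auto
    qed
    define D where "D = (LEAST D. Q D)"
    have D: "Q D" unfolding D_def by (rule LeastI[of Q, OF \<open>Q N\<close>])
    have "real D \<le> D0"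
    proof (cases "D = 0")
      case True
      then show ?thesis using K \<delta>_nonneg by (simp add: D0_def)
    next
      case False
      \<comment> \<open>By minimality some point of the geodesic has distance at least
        \<open>D\<close> from all of \<open>h\<close>; the excursion is centred there.\<close>
      then have "\<not> Q (D - 1)" unfolding D_def by (metis not_less_Least diff_less less_one neq0_conv)
      then obtain t0 where t0: "t0 \<le> N" "\<And>j. j \<le> m \<Longrightarrow> \<not> d (f t0) (h j) \<le> D - 1"
        unfolding Q_def by blast
      then have far: "D \<le> d (f t0) (h j)" if "j \<le> m" for j using that by fastforce
      have exc: "real D \<le> K + 2 * \<delta> + real k * \<delta>" if "6 * K * real D + K \<le> 2 ^ k" for k
        using f h K D far t0(1) that unfolding Q_def by (intro geodesic_excursion[of f N h m]) auto
      have "\<exists>k. 6 * K * real D + K \<le> 2 ^ k"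
        using real_arch_pow[of 2 "6 * K * real D + K"] by (auto intro: less_imp_le)
      then obtain k where k: "6 * K * real D + K \<le> 2 ^ k"
        and min: "\<And>l. l < k \<Longrightarrow> \<not> 6 * K * real D + K \<le> 2 ^ l"
        using exists_least_iff[of "\<lambda>k. 6 * K * real D + K \<le> 2 ^ k"] by blast
      show ?thesis
      proof (cases "k \<le> k0")
        case True
        then have "real k * \<delta> \<le> real k0 * \<delta>" using \<delta>_nonneg by (intro mult_right_mono) auto
        then show ?thesis using exc[OF k] by (simp add: D0_def)
      next
        case False
        \<comment> \<open>Beyond \<open>k0\<close> the exponent \<open>k - 1\<close> would already
          suffice, against the choice of \<open>k\<close>.\<close>
        then obtain l where l: "k = Suc l" "k0 \<le> l" by (cases k) auto
        have "6 * K * real D \<le> 6 * K * (K + 2 * \<delta> + real k * \<delta>)"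
          using exc[OF k] K by (intro mult_left_mono) auto
        also have "\<dots> + K = 6 * K * \<delta> * real l + (6 * K * (K + 3 * \<delta>) + K)"
          by (simp add: l algebra_simps)
        finally have "6 * K * real D + K \<le> 2 ^ l" using k0[OF l(2)] by linarith
        then show ?thesis using min[of l] l by simp
      qed
    qed
    moreover obtain j where "j \<le> m" "d (f t) (h j) \<le> D" using D t unfolding Q_def by blast
    ultimately show ?thesis by (intro exI[of _ j]) auto
  qed
  then show thesis by (rule that)
qed

text \<open>Going from \<open>h p\<close> a distance \<open>t\<close> towards \<open>h j\<close>,
  with \<open>t\<close> at most the product, brings one closer to \<open>g\<close> by at least
  \<open>t - 2 * \<delta>\<close>. That point is within \<open>D\<close> of some \<open>h l\<close>,
  which is no closer to \<open>g\<close> than \<open>h p\<close>; hence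
  \<open>t \<le> D + 2 * \<delta>\<close>.\<close>

lemma gp_nearest:
  assumes near: "\<And>f N t. \<lbrakk>geodesic f N; f 0 = h p; f N = h j; t \<le> N\<rbrakk> \<Longrightarrow> \<exists>l\<le>m. real (d (f t) (h l)) \<le> D"
    and h: "\<And>i. i \<le> m \<Longrightarrow> h i \<in> verts \<Gamma>" and g: "g \<in> verts \<Gamma>"
    and p: "p \<le> m" "\<And>i. i \<le> m \<Longrightarrow> d g (h p) \<le> d g (h i)" and j: "j \<le> m"
  shows "gp (h p) g (h j) \<le> D + 2 * \<delta> + 1"
proof -
  define N x where "N = d (h p) (h j)" and "x = gp (h p) g (h j)"
  have V: "h p \<in> verts \<Gamma>" "h j \<in> verts \<Gamma>" using h p j by auto
  obtain f where f: "geodesic f N" "f 0 = h p" "f N = h j"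
    using geodesic_exists[OF V] unfolding N_def by blast
  have "0 \<le> x" "x \<le> real N"
    using gdist_triangle[OF g V] gdist_triangle[OF g V(2,1)] gdist_sym[OF V]
    by (auto simp: x_def N_def gromov_product_def)
  \<comment> \<open>Geodesics have vertices only at integer times; rounding down costs the 1 in the
    bound.\<close>
  define t where "t = nat \<lfloor>x\<rfloor>"
  have t: "real t \<le> x" "x < real t + 1" "t \<le> N"
    using \<open>0 \<le> x\<close> \<open>x \<le> real N\<close> unfolding t_def by linarith+
  have u: "f t \<in> verts \<Gamma>" using f(1) t(3) by (simp add: geodesic_def)
  have "d (f 0) (f t) = t - 0" "d (f t) (f N) = N - t"
    using f(1) t(3) unfolding geodesic_def by blast+
  then have du: "d (h p) (f t) = t" "d (f t) (h j) = N - t" using f(2,3) by auto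
  have "gp (h p) (h j) (f t) = real t"
    using du gdist_sym[OF V] gdist_sym[OF V(1) u] gdist_sym[OF V(2) u] t(3)
    by (simp add: gromov_product_def of_nat_diff N_def)
  then have "real t - \<delta> \<le> gp (h p) g (f t)"
    using hyperbolic[OF V(1) g V(2) u] t(1) by (simp add: x_def)
  then have 1: "real t - \<delta> \<le> (real (d g (h p)) + real t - real (d g (f t))) / 2"
    using du gdist_sym[OF V(1) u] by (simp add: gromov_product_def)
  obtain l where l: "l \<le> m" "real (d (f t) (h l)) \<le> D" using near[OF f t(3)] by blast
  have "real (d g (h p)) \<le> real (d g (f t)) + real (d (f t) (h l))"
    using p(2)[OF l(1)] gdist_triangle[OF g u h[OF l(1)]] by linarith
  moreover have "2 * (real t - \<delta>) \<le> real (d g (h p)) + real t - real (d g (f t))"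
    using 1 by simp
  ultimately have "2 * (real t - \<delta>) \<le> D + real t" using l(2) by linarith
  then have "real t \<le> D + 2 * \<delta>" by (simp add: algebra_simps)
  then show ?thesis using t(2) unfolding x_def
    by linarith
qed

text \<open>By \<open>gp_nearest\<close> the path \<open>g\<close>, \<open>h p\<close>,
  \<open>h q\<close>, \<open>g'\<close> has small products at both corners, so it is nearly geodesic
  once \<open>h p\<close> and \<open>h q\<close> are far apart.\<close>

theorem quasi_chain_contracting:
  assumes K: "1 \<le> K"
  obtains C where "0 \<le> C" "\<And>h m g g' p q. \<lbrakk>quasi_chain K d m h; \<And>i. i \<le> m \<Longrightarrow> h i \<in> verts \<Gamma>;
      g \<in> verts \<Gamma>; g' \<in> verts \<Gamma>; p \<le> m; q \<le> m;
      \<And>i. i \<le> m \<Longrightarrow> d g (h p) \<le> d g (h i); \<And>i. i \<le> m \<Longrightarrow> d g' (h q) \<le> d g' (h i)\<rbrakk> \<Longrightarrow>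
      real (d (h p) (h q)) \<le> C \<or> real (d g (h p)) + real (d g' (h q)) - C \<le> real (d g g')"
proof -
  obtain D where D: "\<And>f N h m t. \<lbrakk>geodesic f N; f 0 = h 0; f N = h m; quasi_chain K d m h;
    \<And>i. i \<le> m \<Longrightarrow> h i \<in> verts \<Gamma>; t \<le> N\<rbrakk> \<Longrightarrow> \<exists>j\<le>m. real (d (f t) (h j)) \<le> D"
    using geodesic_near_quasi_chain[OF K] by blast
  define K1 where "K1 = max 0 (D + 2 * \<delta> + 1)"
  have "real (d (h p) (h q)) \<le> 4 * K1 + 2 * \<delta> \<or>
      real (d g (h p)) + real (d g' (h q)) - (4 * K1 + 2 * \<delta>) \<le> real (d g g')"
    if h: "quasi_chain K d m h" "\<And>i. i \<le> m \<Longrightarrow> h i \<in> verts \<Gamma>"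
      and g: "g \<in> verts \<Gamma>" "g' \<in> verts \<Gamma>" and pq: "p \<le> m" "q \<le> m"
      and p: "\<And>i. i \<le> m \<Longrightarrow> d g (h p) \<le> d g (h i)" and q: "\<And>i. i \<le> m \<Longrightarrow> d g' (h q) \<le> d g' (h i)"
    for h m g g' p q
  proof -
    \<comment> \<open>A stretch of a chain, read in either direction, is again a chain with the same
      constant.\<close>
    have near: "\<exists>l\<le>m. real (d (f t) (h l)) \<le> D"
      if f: "geodesic f N" "f 0 = h i" "f N = h j" "t \<le> N" and ij: "i \<le> m" "j \<le> m" for f N t i j
    proof (cases "i \<le> j")
      case True
      then have "\<exists>l\<le>j - i. real (d (f t) (h (i + l))) \<le> D"
        using f h(2) ij by (intro D[of f N "\<lambda>l. h (i + l)" "j - i"] quasi_chain_shift[OF h(1)]) auto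
      then show ?thesis using True ij by (metis add_le_mono1 le_add_diff_inverse le_trans add.commute)
    next
      case False
      then have "\<exists>l\<le>i - j. real (d (f t) (h (i - l))) \<le> D"
        using f h(2) ij by (intro D[of f N "\<lambda>l. h (i - l)" "i - j"] quasi_chain_rev_shift[OF h(1)]) auto
      then show ?thesis using ij by (meson diff_le_self le_trans)
    qed
    have V: "h p \<in> verts \<Gamma>" "h q \<in> verts \<Gamma>" using h(2) pq by auto
    have 1: "gp (h p) g (h q) \<le> K1"
      using gp_nearest[of h p q m D g] near pq h(2) g(1) p by (auto simp: K1_def)
    have 2: "gp (h q) g' (h p) \<le> K1"
      using gp_nearest[of h q p m D g'] near pq h(2) g(2) q by (auto simp: K1_def)
    have "0 \<le> K1" by (simp add: K1_def)
    \<comment> \<open>At \<open>h p\<close>, the product of \<open>g'\<close> with \<open>g\<close>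
      or with \<open>h q\<close> is at most \<open>K1 + \<delta>\<close>. In the second case adding
      the product in \<open>2\<close> gives the distance from \<open>h p\<close> to
      \<open>h q\<close>, which is thus bounded. In the first case \<open>2\<close> replaces
      \<open>d g' (h p)\<close> by \<open>d g' (h q)\<close>.\<close>
    with 1 2 \<delta>_nonneg hyperbolic[OF V(1) g V(2)] show ?thesis
      unfolding gromov_product_def gdist_sym[OF V(2,1)] by (intro disjCI) (simp add: field_simps min_def split: if_splits)
  qed
  moreover have "0 \<le> 4 * K1 + 2 * \<delta>" using \<delta>_nonneg by (simp add: K1_def)
  ultimately show thesis using that by blast
qed

end

section \<open>Quasigeodesics of a properly mapped graph\<close>

context connected_graph
begin

text \<open>A discrete connectedness argument: the indices of points of \<open>h\<close> near
  \<open>g k\<close> run from 0 or more to \<open>m\<close>, and where they first reach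
  \<open>j\<close> they jump by a bounded amount only.\<close>

lemma quasi_chain_dense:
  assumes h: "quasi_chain K d m h" "\<And>i. i \<le> m \<Longrightarrow> h i \<in> verts \<Gamma>" and K: "0 \<le> K"
    and g: "\<And>i. i \<le> N \<Longrightarrow> g i \<in> verts \<Gamma>" "g 0 = h 0" "g N = h m"
    and J: "\<And>i. i < N \<Longrightarrow> real (d (g i) (g (Suc i))) \<le> J" "0 \<le> J"
    and D: "\<And>k. k \<le> N \<Longrightarrow> \<exists>j\<le>m. real (d (g k) (h j)) \<le> D"
    and j: "j \<le> m"
  shows "\<exists>k\<le>N. real (d (h j) (g k)) \<le> K * (K * (2 * D + J) + K) + K + D"
proof -
  \<comment> \<open>Forcing the index \<open>m\<close> at the end ensures that every
    \<open>j\<close> is reached.\<close>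
  have ex: "\<exists>i\<le>m. real (d (g k) (h i)) \<le> D \<and> (k = N \<longrightarrow> i = m)" if "k \<le> N" for k
  proof (cases "k = N")
    case True
    have "0 \<le> D" using D[OF that] by (meson of_nat_0_le_iff order_trans)
    then show ?thesis using True g(3) by (intro exI[of _ m]) simp
  qed (use D that in auto)
  obtain i where "\<forall>k\<in>{..N}. i k \<le> m \<and> real (d (g k) (h (i k))) \<le> D \<and> (k = N \<longrightarrow> i k = m)"
    using bchoice[of "{..N}" "\<lambda>k i. i \<le> m \<and> real (d (g k) (h i)) \<le> D \<and> (k = N \<longrightarrow> i = m)"] ex by auto
  then have i: "\<And>k. k \<le> N \<Longrightarrow> i k \<le> m" "\<And>k. k \<le> N \<Longrightarrow> real (d (g k) (h (i k))) \<le> D"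
    "i N = m" by auto
  have D0: "0 \<le> D" using i(2)[of 0] by (meson le0 of_nat_0_le_iff order_trans)
  define k where "k = (LEAST k. j \<le> i k)"
  have k: "j \<le> i k" unfolding k_def by (rule LeastI[of _ N]) (use j i(3) in simp)
  have kN: "k \<le> N" unfolding k_def by (rule Least_le) (use j i(3) in simp)
  have V: "h j \<in> verts \<Gamma>" "g k \<in> verts \<Gamma>" "h (i k) \<in> verts \<Gamma>" using h(2) g(1) j kN i(1) by auto
  \<comment> \<open>The index chosen just before reaching \<open>j\<close> serves as
    \<open>l\<close>; if \<open>j\<close> is reached at time 0, the common start
    \<open>h 0 = g 0\<close> does.\<close>
  have "\<exists>l\<le>m. l \<le> j \<and> real (d (h l) (h (i k))) \<le> 2 * D + J"
  proof (cases k)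
    case 0
    then show ?thesis using i(2)[of 0] g(2) D0 J(2) by (intro exI[of _ 0]) auto
  next
    case (Suc k')
    then have k': "i k' < j" "k' < N"
      using not_less_Least[of k' "\<lambda>k. j \<le> i k"] kN by (auto simp: k_def)
    have V': "g k' \<in> verts \<Gamma>" "h (i k') \<in> verts \<Gamma>" using h(2) g(1) k' i(1) by auto
    have "real (d (h (i k')) (g k')) \<le> D"
      using i(2)[of k'] k'(2) gdist_sym[OF V'] by simp
    moreover have "real (d (g k') (g k)) \<le> J" using J(1)[OF k'(2)] Suc by simp
    ultimately have "real (d (h (i k')) (h (i k))) \<le> 2 * D + J"
      using i(2)[OF kN] gdist_triangle4[OF V'(2,1) V(2,3)] by linarith
    then show ?thesis using k' i(1)[of k'] by (intro exI[of _ "i k'"]) auto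
  qed
  then obtain l where l: "l \<le> m" "l \<le> j" "real (d (h l) (h (i k))) \<le> 2 * D + J" by blast
  have "\<bar>real l - real (i k)\<bar> \<le> K * real (d (h l) (h (i k))) + K"
    using h(1) l(1) i(1)[OF kN] unfolding quasi_chain_def by blast
  also have "\<dots> \<le> K * (2 * D + J) + K" using l(3) K by (intro add_mono mult_left_mono) auto
  finally have "\<bar>real j - real (i k)\<bar> \<le> K * (2 * D + J) + K" using l(2) k by linarith
  then have "K * \<bar>real j - real (i k)\<bar> + K \<le> K * (K * (2 * D + J) + K) + K"
    using K by (intro add_mono mult_left_mono) auto
  moreover have "real (d (h j) (h (i k))) \<le> K * \<bar>real j - real (i k)\<bar> + K"
    using h(1) j i(1)[OF kN] unfolding quasi_chain_def by blast
  ultimately have "real (d (h j) (g k)) \<le> K * (K * (2 * D + J) + K) + K + D"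
    using gdist_triangle[OF V(1,3,2)] gdist_sym[OF V(2,3)] i(2)[OF kN] by linarith
  then show ?thesis using kN by blast
qed

end

text \<open>Each induction step splits off a last block of length \<open>B\<close>; the summand 1
  pays for the incomplete block.\<close>

lemma displacement_le_block_count:
  fixes \<phi> :: "nat \<Rightarrow> nat \<Rightarrow> real"
  assumes tri: "\<And>i j k. \<lbrakk>i \<in> {s..t}; j \<in> {s..t}; k \<in> {s..t}\<rbrakk> \<Longrightarrow> \<phi> i k \<le> \<phi> i j + \<phi> j k"
    and block: "\<And>i j. \<lbrakk>i \<in> {s..t}; j \<in> {s..t}; i \<le> j; j \<le> i + B\<rbrakk> \<Longrightarrow> \<phi> i j \<le> C"
    and B: "0 < B" and C: "0 \<le> C"
  shows "s + l \<le> t \<Longrightarrow> \<phi> s (s + l) \<le> C * (real l / real B + 1)"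
proof (induction l rule: less_induct)
  case (less l)
  show ?case
  proof (cases "l \<le> B")
    case True
    then have "\<phi> s (s + l) \<le> C" using less.prems by (intro block) auto
    also have "\<dots> \<le> C * (real l / real B + 1)" using C mult_left_mono[of 1 "real l / real B + 1" C] by simp
    finally show ?thesis .
  next
    case False
    then have "\<phi> s (s + l) \<le> \<phi> s (s + (l - B)) + \<phi> (s + (l - B)) (s + l)"
      using less.prems by (intro tri) auto
    also have "\<phi> (s + (l - B)) (s + l) \<le> C" using less.prems False by (intro block) auto
    also have "\<phi> s (s + (l - B)) \<le> C * (real (l - B) / real B + 1)"
      using less False B by (intro less.IH) auto
    also have "C * (real (l - B) / real B + 1) + C = C * (real l / real B + 1)"
      using False B by (simp add: field_simps of_nat_diff)
    finally show ?thesis by simp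
  qed
qed

text \<open>During an excursion of \<open>g\<close> the projection to \<open>h\<close> moves at most \<open>C\<close> per \<open>B\<close> steps. Choosing \<open>B\<close>
  larger than \<open>2 * K ^ 3 * C\<close> makes this at most half the speed that a quasigeodesic of \<open>\<Delta>\<close> must have.\<close>

theorem (in hyperbolic_graph) quasi_chain_near:
  fixes \<Delta> :: "'g sgraph" and F :: "nat \<Rightarrow> nat"
  assumes "connected_graph \<Delta>" and \<iota>: "\<And>x. x \<in> verts \<Delta> \<Longrightarrow> \<iota> x \<in> verts \<Gamma>" and K: "1 \<le> K"
    and lip: "\<And>x y. \<lbrakk>x \<in> verts \<Delta>; y \<in> verts \<Delta>\<rbrakk> \<Longrightarrow>
      real (gdist \<Gamma> (\<iota> x) (\<iota> y)) \<le> K * real (gdist \<Delta> x y) + K"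
    and proper: "\<And>x y. \<lbrakk>x \<in> verts \<Delta>; y \<in> verts \<Delta>\<rbrakk> \<Longrightarrow> gdist \<Delta> x y \<le> F (gdist \<Gamma> (\<iota> x) (\<iota> y))"
    and F: "mono F"
  obtains D :: real where "\<And>m h N g k. \<lbrakk>\<And>i. i \<le> m \<Longrightarrow> h i \<in> verts \<Delta>; quasi_chain K (gdist \<Gamma>) m (\<lambda>i. \<iota> (h i));
      quasi_chain K (gdist \<Delta>) m h; \<And>i. i \<le> N \<Longrightarrow> g i \<in> verts \<Delta>; quasi_chain K (gdist \<Delta>) N g;
      g 0 = h 0; g N = h m; k \<le> N\<rbrakk> \<Longrightarrow> \<exists>j\<le>m. real (gdist \<Delta> (g k) (h j)) \<le> D"
proof -
  interpret \<Delta>: connected_graph \<Delta> by fact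
  obtain C where C: "0 \<le> C" and contr: "\<And>h m g g' p q. \<lbrakk>quasi_chain K d m h; \<And>i. i \<le> m \<Longrightarrow> h i \<in> verts \<Gamma>;
      g \<in> verts \<Gamma>; g' \<in> verts \<Gamma>; p \<le> m; q \<le> m;
      \<And>i. i \<le> m \<Longrightarrow> d g (h p) \<le> d g (h i); \<And>i. i \<le> m \<Longrightarrow> d g' (h q) \<le> d g' (h i)\<rbrakk> \<Longrightarrow>
      real (d (h p) (h q)) \<le> C \<or> real (d g (h p)) + real (d g' (h q)) - C \<le> real (d g g')"
    using quasi_chain_contracting[OF K] by blast
  \<comment> \<open>Bounds how far \<open>\<iota> (g i)\<close> can move in \<open>x\<close> units
    of time: a quasigeodesic of \<open>\<Delta>\<close> followed by the coarsely Lipschitz map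
    \<open>\<iota>\<close>.\<close>
  define step where "step = (\<lambda>x. K * (K * x + K) + K)"
  define B where "B = nat \<lceil>2 * K ^ 3 * C\<rceil> + 1"
  \<comment> \<open>Points of an excursion, ends included, are at least \<open>r - step 1\<close>
    from \<open>h\<close>. Two of them at most \<open>B\<close> units of time apart are then too
    close together for the second alternative of the contraction.\<close>
  define r where "r = nat \<lceil>step 1 + step (real B) + C\<rceil> + 1"
  \<comment> \<open>Twice the constant left when the duration of an excursion is estimated by half
    of itself plus a constant.\<close>
  define L where "L = 2 * (K ^ 3 * C + K ^ 3 + K\<^sup>2 + K + 2 * K * real (F r))"
  define R where "R = r + nat \<lceil>step L\<rceil>"
  have B: "0 < B" "2 * K ^ 3 * C \<le> real B" unfolding B_def by linarith+
  have step_mono: "step x \<le> step y" if "x \<le> y" for x y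
    using that K unfolding step_def by (intro add_mono mult_left_mono order_refl) auto
  have step_nonneg: "0 \<le> step x" if "0 \<le> x" for x using that K unfolding step_def by auto
  have r: "step 1 + step (real B) + C < real r" unfolding r_def by linarith
  have L0: "0 \<le> L" using C K unfolding L_def by (intro mult_nonneg_nonneg add_nonneg_nonneg) auto
  have "\<exists>j\<le>m. real (gdist \<Delta> (g k) (h j)) \<le> real (F R)"
    if hV: "\<And>i. i \<le> m \<Longrightarrow> h i \<in> verts \<Delta>" and h\<Gamma>: "quasi_chain K d m (\<lambda>i. \<iota> (h i))"
      and h\<Delta>: "quasi_chain K (gdist \<Delta>) m h" and gV: "\<And>i. i \<le> N \<Longrightarrow> g i \<in> verts \<Delta>"
      and g: "quasi_chain K (gdist \<Delta>) N g" and ends: "g 0 = h 0" "g N = h m" and k: "k \<le> N"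
    for m h N g k
  proof -
    have "\<exists>p\<le>m. \<forall>i\<le>m. d (\<iota> (g i0)) (\<iota> (h p)) \<le> d (\<iota> (g i0)) (\<iota> (h i))" for i0
      using ex_min_if_finite[of "(\<lambda>i. d (\<iota> (g i0)) (\<iota> (h i))) ` {..m}"] by (fastforce simp: not_less)
    then obtain p where p: "\<And>i. p i \<le> m"
      and pmin: "\<And>i j. j \<le> m \<Longrightarrow> d (\<iota> (g i)) (\<iota> (h (p i))) \<le> d (\<iota> (g i)) (\<iota> (h j))" by metis
    define \<rho> where "\<rho> = (\<lambda>i. d (\<iota> (g i)) (\<iota> (h (p i))))"
    have gG: "\<iota> (g i) \<in> verts \<Gamma>" if "i \<le> N" for i using gV \<iota> that by blast
    have hG: "\<iota> (h i) \<in> verts \<Gamma>" if "i \<le> m" for i using hV \<iota> that by blast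
    have dg: "real (d (\<iota> (g i)) (\<iota> (g j))) \<le> step x" if "i \<le> N" "j \<le> N" "\<bar>real i - real j\<bar> \<le> x" for i j x
    proof -
      have "real (gdist \<Delta> (g i) (g j)) \<le> K * \<bar>real i - real j\<bar> + K"
        using g that unfolding quasi_chain_def by blast
      then have "K * real (gdist \<Delta> (g i) (g j)) + K \<le> step \<bar>real i - real j\<bar>"
        unfolding step_def using K by (intro add_mono mult_left_mono order_refl) auto
      then show ?thesis using lip[OF gV gV] that step_mono[OF that(3)] by (meson order_trans)
    qed
    have \<rho>_lip: "real (\<rho> i) \<le> step x + real (\<rho> j)" if "i \<le> N" "j \<le> N" "\<bar>real i - real j\<bar> \<le> x" for i j x
    proof -
      have "\<rho> i \<le> d (\<iota> (g i)) (\<iota> (h (p j)))" unfolding \<rho>_def by (rule pmin[OF p])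
      also have "\<dots> \<le> d (\<iota> (g i)) (\<iota> (g j)) + \<rho> j"
        unfolding \<rho>_def using gG hG p that by (intro gdist_triangle) auto
      finally show ?thesis using dg[OF that] by linarith
    qed
    have "\<rho> k \<le> R"
    proof (cases "\<rho> k \<le> r")
      case False
      have \<rho>0: "\<rho> 0 = 0" "\<rho> N = 0" using pmin[of 0 0] pmin[of m N] ends by (auto simp: \<rho>_def)
      \<comment> \<open>The excursion around \<open>k\<close> lies between the last time before and
        the first time after \<open>k\<close> at distance at most \<open>r\<close>; both exist as
        \<open>\<rho>\<close> vanishes at the common endpoints.\<close>
      define s where "s = (GREATEST i. i \<le> k \<and> \<rho> i \<le> r)"
      define t where "t = (LEAST i. k \<le> i \<and> \<rho> i \<le> r)"
      have "s \<le> k \<and> \<rho> s \<le> r"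
        unfolding s_def by (rule GreatestI_nat[of _ 0 k]) (use \<rho>0 in auto)
      then have s: "s \<le> k" "\<rho> s \<le> r" by auto
      have "k \<le> t \<and> \<rho> t \<le> r" unfolding t_def by (rule LeastI[of _ N]) (use \<rho>0 k in auto)
      then have t: "k \<le> t" "\<rho> t \<le> r" by auto
      have tN: "t \<le> N" unfolding t_def by (rule Least_le) (use \<rho>0 k in auto)
      have out: "r < \<rho> i" if "s < i" "i < t" for i
      proof (cases "i \<le> k")
        case True
        then show ?thesis
          using that Greatest_le_nat[of "\<lambda>i. i \<le> k \<and> \<rho> i \<le> r" i k] unfolding s_def by fastforce
      next
        case False
        then show ?thesis using that not_less_Least[of i "\<lambda>i. k \<le> i \<and> \<rho> i \<le> r"] unfolding t_def by fastforce
      qed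
      have st: "s < k" "k < t" using s t False by (auto simp: order_less_le)
      \<comment> \<open>The times \<open>s\<close> and \<open>t\<close> are within \<open>r\<close>,
        but they adjoin times outside, so \<open>\<rho>\<close> has dropped by at most
        \<open>step 1\<close>.\<close>
      have out': "real r - step 1 \<le> real (\<rho> i)" if "s \<le> i" "i \<le> t" for i
      proof -
        consider "i = s" | "i = t" | "s < i" "i < t" using \<open>s \<le> i\<close> \<open>i \<le> t\<close> by fastforce
        then show ?thesis
        proof cases
          case 1
          then have "real (\<rho> (Suc i)) \<le> step 1 + real (\<rho> i)" using st tN by (intro \<rho>_lip) auto
          moreover have "r \<le> \<rho> (Suc i)"
            using out[of "Suc i"] st 1 by (cases "Suc i = t") auto
          ultimately show ?thesis by linarith
        next
          case 2
          then have "real (\<rho> (i - 1)) \<le> step 1 + real (\<rho> i)" using st tN by (intro \<rho>_lip) auto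
          moreover have "r \<le> \<rho> (i - 1)"
          proof -
            have "s < i - 1" "i - 1 < t" using st 2 by linarith+
            then show ?thesis using out[of "i - 1"] by linarith
          qed
          ultimately show ?thesis by linarith
        next
          case 3
          then show ?thesis using out[of i] step_nonneg[of 1] by linarith
        qed
      qed
      have block: "real (d (\<iota> (h (p i))) (\<iota> (h (p j)))) \<le> C"
        if "i \<in> {s..t}" "j \<in> {s..t}" "i \<le> j" "j \<le> i + B" for i j
      proof -
        have "real (d (\<iota> (g i)) (\<iota> (g j))) \<le> step (real B)"
          using that tN by (intro dg) auto
        moreover have "real r - step 1 \<le> real (\<rho> i)" "real r - step 1 \<le> real (\<rho> j)"
          using out' that by auto
        ultimately have "\<not> real (\<rho> i) + real (\<rho> j) - C \<le> real (d (\<iota> (g i)) (\<iota> (g j)))"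
          using r step_nonneg[of "real B"] C by simp
        then show ?thesis
          using contr[OF h\<Gamma> hG gG gG p p pmin pmin, of i j] that tN unfolding \<rho>_def by auto
      qed
      have "real (d (\<iota> (h (p s))) (\<iota> (h (p (s + (t - s)))))) \<le> C * (real (t - s) / real B + 1)"
      proof (rule displacement_le_block_count[where \<phi> = "\<lambda>i j. real (d (\<iota> (h (p i))) (\<iota> (h (p j))))" and s = s and t = t])
        show "real (d (\<iota> (h (p i))) (\<iota> (h (p k)))) \<le>
            real (d (\<iota> (h (p i))) (\<iota> (h (p j)))) + real (d (\<iota> (h (p j))) (\<iota> (h (p k))))" for i j k
          using gdist_triangle[OF hG[OF p] hG[OF p] hG[OF p]] by (metis of_nat_add of_nat_mono)
      qed (use block B(1) C st in simp_all)
      then have disp: "real (d (\<iota> (h (p s))) (\<iota> (h (p t)))) \<le> C * (real (t - s) / real B + 1)"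
        using st by simp
      define x where "x = real (t - s)"
      define y where "y = C * (x / real B + 1)"
      \<comment> \<open>Since \<open>h\<close> is a chain for both metrics, displacement in
        \<open>\<Gamma>\<close> bounds the time along \<open>h\<close>, and this bounds displacement
        in \<open>\<Delta>\<close> linearly. Applying \<open>proper\<close> here would give only a
        bound through \<open>F\<close>.\<close>
      have "\<bar>real (p s) - real (p t)\<bar> \<le> K * real (d (\<iota> (h (p s))) (\<iota> (h (p t)))) + K"
        using h\<Gamma> p unfolding quasi_chain_def by blast
      also have "\<dots> \<le> K * y + K"
        using disp K unfolding x_def y_def by (intro add_mono mult_left_mono) auto
      finally have 1: "\<bar>real (p s) - real (p t)\<bar> \<le> K * y + K" .
      have "real (gdist \<Delta> (h (p s)) (h (p t))) \<le> K * \<bar>real (p s) - real (p t)\<bar> + K"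
        using h\<Delta> p unfolding quasi_chain_def by blast
      also have "\<dots> \<le> K * (K * y + K) + K" using 1 K by (intro add_mono mult_left_mono) auto
      finally have 2: "real (gdist \<Delta> (h (p s)) (h (p t))) \<le> K * (K * y + K) + K" .
      \<comment> \<open>At the ends of the excursion \<open>proper\<close> is applied to distances
        at most \<open>r\<close>, so it costs a constant.\<close>
      have end_close: "gdist \<Delta> (g i) (h (p i)) \<le> F r" if "i \<le> N" "\<rho> i \<le> r" for i
        using proper[OF gV hV, OF that(1) p] monoD[OF F that(2)] unfolding \<rho>_def by (meson order_trans)
      have VD: "g s \<in> verts \<Delta>" "g t \<in> verts \<Delta>" "h (p s) \<in> verts \<Delta>" "h (p t) \<in> verts \<Delta>"
        using gV hV p st tN by auto
      have 3: "real (gdist \<Delta> (g s) (g t)) \<le> 2 * real (F r) + (K * (K * y + K) + K)"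
        using \<Delta>.gdist_triangle4[OF VD(1,3,4,2)] end_close[of s] end_close[of t] s t tN st 2
          \<Delta>.gdist_sym[OF VD(2,4)] by linarith
      have "\<bar>real s - real t\<bar> \<le> K * real (gdist \<Delta> (g s) (g t)) + K"
        using g order_trans[OF s(1) k] tN unfolding quasi_chain_def by blast
      also have "\<dots> \<le> K * (2 * real (F r) + (K * (K * y + K) + K)) + K"
        using 3 K by (intro add_mono mult_left_mono) auto
      finally have 4: "x \<le> K * (2 * real (F r) + (K * (K * y + K) + K)) + K"
        using st unfolding x_def by (simp add: of_nat_diff)
      \<comment> \<open>The choice of \<open>B\<close> lets the term linear in the duration be
        absorbed into the left side.\<close>
      have "K ^ 3 * C * (x / real B) \<le> x / 2"
      proof -
        have "2 * K ^ 3 * C * x \<le> real B * x" using B(2) by (intro mult_right_mono) (auto simp: x_def)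
        then show ?thesis using B(1) by (simp add: field_simps)
      qed
      then have "K ^ 3 * y \<le> x / 2 + K ^ 3 * C" by (simp add: y_def algebra_simps)
      moreover have "K * (2 * real (F r) + (K * (K * y + K) + K)) + K =
          K ^ 3 * y + K ^ 3 + K\<^sup>2 + K + 2 * K * real (F r)"
        by (simp add: algebra_simps power2_eq_square power3_eq_cube)
      ultimately have "x \<le> x / 2 + (K ^ 3 * C + K ^ 3 + K\<^sup>2 + K + 2 * K * real (F r))"
        using 4 by simp
      then have xL: "x \<le> L" by (simp add: L_def field_simps)
      have "real (\<rho> k) \<le> step L + real (\<rho> s)"
        using xL st tN by (intro \<rho>_lip) (auto simp: x_def)
      then show ?thesis using s(2) unfolding R_def by linarith
    qed (simp add: R_def)
    then have "gdist \<Delta> (g k) (h (p k)) \<le> F R"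
      using proper[OF gV hV, OF k p] monoD[OF F] unfolding \<rho>_def by (meson order_trans)
    then show ?thesis using p by (intro exI[of _ "p k"]) auto
  qed
  then show thesis by (rule that)
qed

section \<open>Cayley graphs\<close>

lemma (in connected_graph) gdist_map_le:
  assumes "connected_graph \<Delta>" and \<phi>: "\<And>x. x \<in> verts \<Delta> \<Longrightarrow> \<phi> x \<in> verts \<Gamma>"
    and M: "\<And>x y. (x, y) \<in> edges \<Delta> \<Longrightarrow> d (\<phi> x) (\<phi> y) \<le> M"
    and x: "x \<in> verts \<Delta>" and y: "y \<in> verts \<Delta>"
  shows "d (\<phi> x) (\<phi> y) \<le> M * gdist \<Delta> x y"
proof -
  interpret \<Delta>: connected_graph \<Delta> by fact
  have "y \<in> verts \<Delta> \<and> d (\<phi> x) (\<phi> y) \<le> M * n" if "(x, y) \<in> edges \<Delta> ^^ n" for n y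
    using that
  proof (induction n arbitrary: y)
    case (Suc n)
    then obtain z where z: "(x, z) \<in> edges \<Delta> ^^ n" "(z, y) \<in> edges \<Delta>" by (elim relpow_Suc_E)
    have "z \<in> verts \<Delta>" "y \<in> verts \<Delta>" using \<Delta>.edges_verts z(2) by auto
    then have "d (\<phi> x) (\<phi> y) \<le> d (\<phi> x) (\<phi> z) + d (\<phi> z) (\<phi> y)"
      using x by (intro gdist_triangle \<phi>)
    then show ?case using Suc.IH[OF z(1)] M[OF z(2)] \<open>y \<in> verts \<Delta>\<close> by simp
  qed (use x in simp)
  then show ?thesis using \<Delta>.gdist_relpow[OF x y] by blast
qed

lemma verts_cayley_graph [simp]: "verts (cayley_graph G C T) = C"
  by (simp add: cayley_graph_def)

section \<open>Cosets and word metrics\<close>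

context group
begin

lemma lcosetsD:
  assumes "subgroup K G" "C \<in> lcosets K"
  shows "C \<subseteq> carrier G" "\<And>x w. x \<in> C \<Longrightarrow> w \<in> K \<Longrightarrow> x \<otimes> w \<in> C"
    "\<And>x y. x \<in> C \<Longrightarrow> y \<in> C \<Longrightarrow> inv x \<otimes> y \<in> K"
proof -
  obtain a where a: "a \<in> carrier G" "C = a <# K" using assms(2) unfolding LCOSETS_def by blast
  have K: "K \<subseteq> carrier G" using assms(1) by (rule subgroup.subset)
  show "C \<subseteq> carrier G" using a K by (simp add: l_coset_subset_G)
  show "x \<otimes> w \<in> C" if "x \<in> C" "w \<in> K" for x w
    using that a K assms(1) unfolding l_coset_def
    by (auto simp: m_assoc subset_iff intro: subgroup.m_closed)
  show "inv x \<otimes> y \<in> K" if "x \<in> C" "y \<in> C" for x y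
  proof -
    obtain u v where uv: "u \<in> K" "x = a \<otimes> u" "v \<in> K" "y = a \<otimes> v"
      using \<open>x \<in> C\<close> \<open>y \<in> C\<close> unfolding a(2) l_coset_def by blast
    have "inv x \<otimes> y = inv u \<otimes> v"
      using uv a K by (simp add: inv_mult_group subset_iff m_assoc inv_solve_left')
    then show ?thesis using uv assms(1) by (simp add: subgroup.m_closed subgroup.m_inv_closed)
  qed
qed

lemma subgroup_in_lcosets: "subgroup K G \<Longrightarrow> K \<in> lcosets K"
  unfolding LCOSETS_def l_coset_def using subgroup.subset[of K G]
  by (intro UN_I[of \<one>]) (auto simp: subset_iff intro!: bexI)

text \<open>One \<open>m\<close> serves all cosets and base points, since the word for
  \<open>w\<close> is read off from \<open>x\<close>. Only \<open>l \<le> m\<close> can be asked: a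
  trivial generator gives no edge.\<close>

lemma cayley_word_path:
  assumes T: "T \<subseteq> carrier G" and w: "w \<in> generate G T"
  shows "\<exists>m. \<forall>C\<in>lcosets (generate G T). \<forall>x\<in>C.
    \<exists>l\<le>m. (x, x \<otimes> w) \<in> edges (cayley_graph G C T) ^^ l"
  using w
proof induction
  case one
  have "(x, x \<otimes> \<one>) \<in> edges (cayley_graph G C T) ^^ 0"
    if "C \<in> lcosets (generate G T)" "x \<in> C" for C x
    using lcosetsD(1)[OF generate_is_subgroup[OF T] that(1)] that(2) by (simp add: subset_iff)
  then show ?case by blast
next
  case (incl h)
  have "\<exists>l\<le>1. (x, x \<otimes> h) \<in> edges (cayley_graph G C T) ^^ l"
    if C: "C \<in> lcosets (generate G T)" "x \<in> C" for C x
  proof (cases "x = x \<otimes> h")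
    case False
    then have "(x, x \<otimes> h) \<in> edges (cayley_graph G C T) ^^ 1"
      using lcosetsD(2)[OF generate_is_subgroup[OF T] C] generate.incl[OF incl] incl C(2)
      by (auto simp: cayley_graph_def)
    then show ?thesis by blast
  qed (auto intro!: exI[of _ 0])
  then show ?case by blast
next
  case (inv h)
  have "\<exists>l\<le>1. (x, x \<otimes> inv h) \<in> edges (cayley_graph G C T) ^^ l"
    if C: "C \<in> lcosets (generate G T)" "x \<in> C" for C x
  proof (cases "x = x \<otimes> inv h")
    case False
    have "x \<in> carrier G" "h \<in> carrier G"
      using lcosetsD(1)[OF generate_is_subgroup[OF T] C(1)] C(2) T inv by auto
    then have "x = x \<otimes> inv h \<otimes> h" by (simp add: m_assoc)
    then have "(x, x \<otimes> inv h) \<in> edges (cayley_graph G C T) ^^ 1"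
      using lcosetsD(2)[OF generate_is_subgroup[OF T] C] generate.inv[OF inv] inv C(2) False
      by (auto simp: cayley_graph_def)
    then show ?thesis by blast
  qed (auto intro!: exI[of _ 0])
  then show ?case by blast
next
  case (eng h1 h2)
  then obtain m1 m2 where
    m: "\<forall>C\<in>lcosets (generate G T). \<forall>x\<in>C. \<exists>l\<le>m1. (x, x \<otimes> h1) \<in> edges (cayley_graph G C T) ^^ l"
      "\<forall>C\<in>lcosets (generate G T). \<forall>x\<in>C. \<exists>l\<le>m2. (x, x \<otimes> h2) \<in> edges (cayley_graph G C T) ^^ l"
    by blast
  have "\<exists>l\<le>m1 + m2. (x, x \<otimes> (h1 \<otimes> h2)) \<in> edges (cayley_graph G C T) ^^ l"
    if C: "C \<in> lcosets (generate G T)" "x \<in> C" for C x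
  proof -
    have 1: "x \<otimes> h1 \<in> C" using lcosetsD(2)[OF generate_is_subgroup[OF T] C] eng(1) .
    have "x \<in> carrier G" using lcosetsD(1)[OF generate_is_subgroup[OF T] C(1)] C(2) by auto
    then have eq: "x \<otimes> (h1 \<otimes> h2) = x \<otimes> h1 \<otimes> h2"
      using generate_in_carrier[OF T] eng(1,2) by (simp add: m_assoc)
    obtain l1 l2 where "l1 \<le> m1" "(x, x \<otimes> h1) \<in> edges (cayley_graph G C T) ^^ l1"
      "l2 \<le> m2" "(x \<otimes> h1, x \<otimes> h1 \<otimes> h2) \<in> edges (cayley_graph G C T) ^^ l2"
      using m C 1 by blast
    then show ?thesis unfolding eq
      by (intro exI[of _ "l1 + l2"]) (auto simp: relpow_add)
  qed
  then show ?case by blast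
qed

lemma connected_cayley_graph:
  assumes T: "T \<subseteq> carrier G" and C: "C \<in> lcosets (generate G T)"
  shows "connected_graph (cayley_graph G C T)"
proof
  show "sym (edges (cayley_graph G C T))" by (auto simp: cayley_graph_def sym_def)
  show "edges (cayley_graph G C T) \<subseteq> verts (cayley_graph G C T) \<times> verts (cayley_graph G C T)"
    by (auto simp: cayley_graph_def)
  fix u v assume "u \<in> verts (cayley_graph G C T)" "v \<in> verts (cayley_graph G C T)"
  then have uv: "u \<in> C" "v \<in> C" by auto
  note K = generate_is_subgroup[OF T]
  have "inv u \<otimes> v \<in> generate G T" by (rule lcosetsD(3)[OF K C uv])
  then have "\<exists>l. (u, u \<otimes> (inv u \<otimes> v)) \<in> edges (cayley_graph G C T) ^^ l"
    using cayley_word_path[OF T] C uv by blast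
  moreover have "u \<otimes> (inv u \<otimes> v) = v"
    using lcosetsD(1)[OF K C] uv by (simp add: subset_iff m_assoc[symmetric])
  ultimately show "\<exists>l. (u, v) \<in> edges (cayley_graph G C T) ^^ l" by simp
qed

lemma word_length:
  assumes T: "T \<subseteq> carrier G" and w: "w \<in> generate G T"
  obtains m where "\<And>C x. C \<in> lcosets (generate G T) \<Longrightarrow> x \<in> C \<Longrightarrow> gdist (cayley_graph G C T) x (x \<otimes> w) \<le> m"
proof -
  obtain m where m: "\<And>C x. C \<in> lcosets (generate G T) \<Longrightarrow> x \<in> C \<Longrightarrow>
    \<exists>l\<le>m. (x, x \<otimes> w) \<in> edges (cayley_graph G C T) ^^ l"
    using cayley_word_path[OF assms] by blast
  have "gdist (cayley_graph G C T) x (x \<otimes> w) \<le> m" if "C \<in> lcosets (generate G T)" "x \<in> C" for C x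
    using m[OF that] connected_graph.gdist_le[OF connected_cayley_graph[OF T that(1)]] order_trans by blast
  then show thesis by (rule that)
qed

text \<open>An edge for \<open>T\<close> is a word in \<open>A\<close> of bounded length, because
  \<open>T\<close> is finite. Allowing \<open>C\<close> inside a larger \<open>D\<close> covers both
  a change of generators and the inclusion of a subgroup.\<close>

lemma cayley_lipschitz:
  assumes T: "finite T" "T \<subseteq> generate G A" and A: "A \<subseteq> carrier G"
  obtains M where "\<And>C D x y. \<lbrakk>C \<in> lcosets (generate G T); D \<in> lcosets (generate G A); C \<subseteq> D; x \<in> C; y \<in> C\<rbrakk>
    \<Longrightarrow> gdist (cayley_graph G D A) x y \<le> M * gdist (cayley_graph G C T) x y"
proof -
  have TG: "T \<subseteq> carrier G" using T(2) generate_incl[OF A] by blast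
  have "\<exists>m. \<forall>D\<in>lcosets (generate G A). \<forall>x\<in>D. gdist (cayley_graph G D A) x (x \<otimes> w) \<le> m"
    if "w \<in> T" for w
    using word_length[OF A, of w] that T(2) by (metis subsetD)
  then obtain m where m: "\<And>w D x. w \<in> T \<Longrightarrow> D \<in> lcosets (generate G A) \<Longrightarrow> x \<in> D \<Longrightarrow>
    gdist (cayley_graph G D A) x (x \<otimes> w) \<le> m w" by metis
  \<comment> \<open>Inserting 0 gives the maximum a value for empty \<open>T\<close>.\<close>
  define M where "M = Max (insert 0 (m ` T))"
  have mM: "m w \<le> M" if "w \<in> T" for w unfolding M_def using that T(1) by (intro Max_ge) auto
  have "gdist (cayley_graph G D A) x y \<le> M * gdist (cayley_graph G C T) x y"
    if C: "C \<in> lcosets (generate G T)" "x \<in> C" "y \<in> C"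
      and D: "D \<in> lcosets (generate G A)" "C \<subseteq> D" for C D x y
  proof -
    interpret D: connected_graph "cayley_graph G D A" by (rule connected_cayley_graph[OF A D(1)])
    have "gdist (cayley_graph G D A) u v \<le> M" if "(u, v) \<in> edges (cayley_graph G C T)" for u v
    proof -
      obtain s where s: "u \<in> D" "v \<in> D" "s \<in> T" "v = u \<otimes> s \<or> u = v \<otimes> s"
        using \<open>(u, v) \<in> _\<close> D(2) by (auto simp: cayley_graph_def)
      have "gdist (cayley_graph G D A) u v \<le> m s"
        using s m[OF s(3) D(1) s(1)] m[OF s(3) D(1) s(2)] D.gdist_sym[of u v] by auto
      then show ?thesis using mM[OF s(3)] by simp
    qed
    then show ?thesis
      using D(2) C(2,3) D.gdist_map_le[OF connected_cayley_graph[OF TG C(1)], of "\<lambda>x. x" M x y]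
      by auto
  qed
  then show thesis using that by blast
qed

end

section \<open>The cusped space\<close>

fun cusp_base :: "'a cusp_vertex \<Rightarrow> 'a"
  where "cusp_base (Base g) = g" | "cusp_base (Deep i g k) = g"

fun cusp_level :: "'a cusp_vertex \<Rightarrow> nat"
  where "cusp_level (Base g) = 0" | "cusp_level (Deep i g k) = k"

lemma cusp_base_incl [simp]: "cusp_base (horoball_incl i (g, k)) = g"
  and cusp_level_incl [simp]: "cusp_level (horoball_incl i (g, k)) = k"
  and horoball_incl_0: "horoball_incl i (g, 0) = Base g"
  by auto

declare horoball_incl.simps [simp del]

section \<open>Edges of horoballs and of the cusped space\<close>

lemma horoball_edgeE:
  assumes "((g, k), (h, l)) \<in> edges (horoball \<Gamma>)"
  obtains "k = 0" "l = 0" "(g, h) \<in> edges \<Gamma>"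
    | "k = l" "g \<in> verts \<Gamma>" "h \<in> verts \<Gamma>" "1 \<le> k" "0 < gdist \<Gamma> g h" "gdist \<Gamma> g h \<le> 2 ^ k"
    | "g = h" "g \<in> verts \<Gamma>" "l = Suc k \<or> k = Suc l"
  using assms unfolding horoball_def by auto

lemma sym_horoball:
  assumes "connected_graph \<Gamma>"
  shows "sym (edges (horoball \<Gamma>))"
proof (rule symI)
  interpret connected_graph \<Gamma> by fact
  fix u v assume "(u, v) \<in> edges (horoball \<Gamma>)"
  moreover obtain g k h l where uv: "u = (g, k)" "v = (h, l)" by (cases u, cases v)
  ultimately have "((g, k), (h, l)) \<in> edges (horoball \<Gamma>)" by simp
  then have "((h, l), (g, k)) \<in> edges (horoball \<Gamma>)"
  proof (cases rule: horoball_edgeE)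
    case 1
    then show ?thesis using sym_edges by (auto simp: horoball_def dest: symD)
  next
    case 2
    then show ?thesis using gdist_sym[OF 2(2,3)] by (auto simp: horoball_def)
  next
    case 3
    then show ?thesis by (auto simp: horoball_def)
  qed
  then show "(v, u) \<in> edges (horoball \<Gamma>)" using uv by simp
qed

lemma sym_map_prod: "sym E \<Longrightarrow> sym (map_prod f f ` E)"
  by (auto simp: sym_def image_iff Bex_def; metis)

locale cusped_group = group G for G :: "('a, 'm) monoid_scheme" (structure) +
  fixes S :: "'a set" and n :: nat and P :: "nat \<Rightarrow> 'a set"
  assumes S: "finitely_generates G S (carrier G)"
    and P: "i \<in> {1..n} \<Longrightarrow> subgroup (P i) G"
    and S_P: "i \<in> {1..n} \<Longrightarrow> generate G (S \<inter> P i) = P i"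
begin

abbreviation "X \<equiv> cusp G S n P"
abbreviation "Cay \<equiv> cayley_graph G (carrier G) S"

lemma S_carrier: "finite S" "S \<subseteq> carrier G" "generate G S = carrier G"
  using S by (auto simp: finitely_generates_def)

lemma carrier_lcoset: "carrier G \<in> lcosets (carrier G)"
  by (rule subgroup_in_lcosets[OF subgroup_self])

sublocale Cay: connected_graph Cay
  using carrier_lcoset S_carrier by (intro connected_cayley_graph) auto

lemma coset_connected:
  assumes "i \<in> {1..n}" "C \<in> lcosets (P i)"
  shows "connected_graph (cayley_graph G C (S \<inter> P i))"
  using assms S_P S_carrier(2) by (intro connected_cayley_graph) auto

lemma coset_subset: "i \<in> {1..n} \<Longrightarrow> C \<in> lcosets (P i) \<Longrightarrow> C \<subseteq> carrier G"
  using lcosetsD(1)[OF P] .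

lemma verts_cusp:
  "v \<in> verts X \<longleftrightarrow> (\<exists>g\<in>carrier G. v = Base g) \<or>
    (\<exists>i\<in>{1..n}. \<exists>C\<in>lcosets (P i). \<exists>g\<in>C. \<exists>k. v = horoball_incl i (g, k))"
  unfolding cusp_def coset_horoball_def horoball_def by (simp add: image_iff Bex_def) blast

lemma verts_cusp_base: "v \<in> verts X \<Longrightarrow> cusp_base v \<in> carrier G"
  unfolding verts_cusp by (metis coset_subset subsetD cusp_base.simps(1) cusp_base_incl)

lemma verts_cusp_Base [simp]: "Base g \<in> verts X \<longleftrightarrow> g \<in> carrier G"
  using verts_cusp_base[of "Base g"] by (auto simp: verts_cusp)

lemma verts_cusp_incl:
  "i \<in> {1..n} \<Longrightarrow> C \<in> lcosets (P i) \<Longrightarrow> g \<in> C \<Longrightarrow> horoball_incl i (g, k) \<in> verts X"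
  unfolding verts_cusp by blast

lemma edges_cuspI:
  assumes "i \<in> {1..n}" "C \<in> lcosets (P i)" "(p, q) \<in> edges (coset_horoball G S (P i) C)"
  shows "(horoball_incl i p, horoball_incl i q) \<in> edges X"
  unfolding cusp_def sgraph.simps
  by (intro UnI2 UN_I[OF assms(1)] UN_I[OF assms(2)] map_prod_imageI assms(3))

lemma cusp_edgeE:
  assumes "(u, v) \<in> edges X"
  obtains g h where "u = Base g" "v = Base h" "(g, h) \<in> edges Cay"
  | i C g k h l where "i \<in> {1..n}" "C \<in> lcosets (P i)" "u = horoball_incl i (g, k)"
      "v = horoball_incl i (h, l)" "((g, k), (h, l)) \<in> edges (coset_horoball G S (P i) C)"
  using assms unfolding cusp_def by auto

lemma horoball_verts:
  assumes "((g, k), (h, l)) \<in> edges (coset_horoball G S (P i) C)"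
  shows "g \<in> C" "h \<in> C"
  using assms unfolding coset_horoball_def
  by (cases rule: horoball_edgeE; auto simp: cayley_graph_def)+

lemma incl_edge:
  assumes "i \<in> {1..n}" "C \<in> lcosets (P i)" "g \<in> C"
  shows "(horoball_incl i (g, k), horoball_incl i (g, Suc k)) \<in> edges X"
proof -
  have "((g, k), (g, Suc k)) \<in> edges (coset_horoball G S (P i) C)"
    using assms(3) by (simp add: coset_horoball_def horoball_def)
  then show ?thesis by (rule edges_cuspI[OF assms(1,2)])
qed

lemma vertical_path:
  assumes "i \<in> {1..n}" "C \<in> lcosets (P i)" "g \<in> C"
  shows "(Base g, horoball_incl i (g, k)) \<in> edges X ^^ k"
proof (induction k)
  case (Suc k)
  then show ?case using incl_edge[OF assms, of k] by (rule relpow_Suc_I)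
qed (simp add: horoball_incl_0)

lemma verts_cusp_path:
  assumes "v \<in> verts X"
  shows "(Base (cusp_base v), v) \<in> edges X ^^ cusp_level v"
  using assms vertical_path unfolding verts_cusp by fastforce

lemma Base_path: "(g, h) \<in> edges Cay ^^ m \<Longrightarrow> (Base g, Base h) \<in> edges X ^^ m"
proof (induction m arbitrary: h)
  case (Suc m)
  then obtain z where z: "(g, z) \<in> edges Cay ^^ m" "(z, h) \<in> edges Cay" by (elim relpow_Suc_E)
  from z(2) have "(Base z, Base h) \<in> edges X" by (auto simp: cusp_def)
  then show ?case using Suc.IH[OF z(1)] by (rule relpow_Suc_I[rotated])
qed simp

sublocale X: connected_graph X
proof
  show sym: "sym (edges X)"
  proof -
    have symH: "sym (map_prod (horoball_incl i) (horoball_incl i) ` edges (coset_horoball G S (P i) C))"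
      if "i \<in> {1..n}" "C \<in> lcosets (P i)" for i C
      unfolding coset_horoball_def by (intro sym_map_prod sym_horoball coset_connected that)
    then show ?thesis unfolding cusp_def sgraph.simps
      by (intro sym_Un sym_UNION ballI symH sym_map_prod[OF Cay.sym_edges])
  qed
  show "edges X \<subseteq> verts X \<times> verts X"
  proof (clarify)
    fix u v assume "(u, v) \<in> edges X"
    then show "u \<in> verts X \<and> v \<in> verts X"
    proof (cases rule: cusp_edgeE)
      case 1
      then show ?thesis using Cay.edges_verts by auto
    next
      case 2
      then show ?thesis using horoball_verts[OF 2(5)] verts_cusp_incl by blast
    qed
  qed
  fix u v assume uv: "u \<in> verts X" "v \<in> verts X"
  \<comment> \<open>The path descends from \<open>u\<close> to level 0, crosses the Cayley graph and
    climbs to \<open>v\<close>.\<close>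
  have "\<exists>m. (Base (cusp_base u), Base (cusp_base v)) \<in> edges X ^^ m"
    using Base_path Cay.connected[of "cusp_base u" "cusp_base v"] verts_cusp_base uv by auto
  moreover have "(u, Base (cusp_base u)) \<in> edges X ^^ cusp_level u"
  proof -
    have conv: "(y, x) \<in> edges X ^^ m" if "(x, y) \<in> edges X ^^ m" for x y m
      using that
    proof (induction m arbitrary: y)
      case (Suc m)
      then obtain z where z: "(x, z) \<in> edges X ^^ m" "(z, y) \<in> edges X" by (elim relpow_Suc_E)
      show ?case using relpow_Suc_I2[OF symD[OF sym z(2)] Suc.IH[OF z(1)]] .
    qed simp
    show ?thesis by (rule conv[OF verts_cusp_path[OF uv(1)]])
  qed
  ultimately show "\<exists>m. (u, v) \<in> edges X ^^ m"
    using verts_cusp_path[OF uv(2)] by (meson relpow_trans)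
qed

section \<open>Comparison of the group with the cusped space\<close>

lemma Base_lipschitz:
  assumes "g \<in> carrier G" "h \<in> carrier G"
  shows "X.d (Base g) (Base h) \<le> Cay.d g h"
  using X.gdist_le[OF Base_path] Cay.gdist_relpow assms by simp

text \<open>Horizontal edges at level \<open>k\<close> span at most \<open>2 ^ k\<close> in the
  Cayley graph of the coset, which is a subgraph of that of the group.\<close>

lemma cusp_edge_bound:
  assumes "(u, v) \<in> edges X"
  shows "cusp_level v \<le> Suc (cusp_level u) \<and> Cay.d (cusp_base u) (cusp_base v) \<le> 2 ^ cusp_level u"
  using assms
proof (cases rule: cusp_edgeE)
  case (1 g h)
  then show ?thesis using Cay.gdist_le[of g h 1] by simp
next
  case (2 i C g k h l)
  let ?C = "cayley_graph G C (S \<inter> P i)"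
  interpret C: connected_graph ?C by (rule coset_connected[OF 2(1,2)])
  have gh: "g \<in> C" "h \<in> C" using horoball_verts[OF 2(5)] .
  have "(x, y) \<in> edges Cay" if "(x, y) \<in> edges ?C" for x y
    using that coset_subset[OF 2(1,2)] by (auto simp: cayley_graph_def)
  then have "Cay.d g h \<le> 1 * C.d g h"
    using gh coset_subset[OF 2(1,2)] Cay.gdist_le[where m = 1]
    by (intro Cay.gdist_map_le[OF C.connected_graph_axioms]) auto
  moreover have "l \<le> Suc k \<and> C.d g h \<le> 2 ^ k"
    using 2(5) unfolding coset_horoball_def
  proof (cases rule: horoball_edgeE)
    case 1
    then show ?thesis using C.gdist_le[of g h 1] by simp
  qed auto
  ultimately show ?thesis using 2(3,4) by simp
qed

text \<open>A path of \<open>m\<close> edges starting at level 0 stays below level \<open>m\<close>,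
  or at it, so each edge moves the base point by at most \<open>2 ^ m\<close>.\<close>

lemma cusp_proper:
  assumes "g \<in> carrier G" "h \<in> carrier G"
  shows "Cay.d g h \<le> X.d (Base g) (Base h) * 2 ^ X.d (Base g) (Base h)"
proof -
  have "v \<in> verts X \<and> cusp_level v \<le> m \<and> Cay.d g (cusp_base v) \<le> m * 2 ^ m"
    if "(Base g, v) \<in> edges X ^^ m" for m v
    using that
  proof (induction m arbitrary: v)
    case (Suc m)
    then obtain z where z: "(Base g, z) \<in> edges X ^^ m" "(z, v) \<in> edges X" by (elim relpow_Suc_E)
    note IH = Suc.IH[OF z(1)]
    have V: "z \<in> verts X" "v \<in> verts X" using z(2) X.edges_verts by auto
    have "Cay.d g (cusp_base v) \<le> Cay.d g (cusp_base z) + Cay.d (cusp_base z) (cusp_base v)"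
      using assms verts_cusp_base V by (intro Cay.gdist_triangle) auto
    also have "\<dots> \<le> m * 2 ^ m + 2 ^ cusp_level z" using IH cusp_edge_bound[OF z(2)] by (intro add_mono) auto
    also have "(2::nat) ^ cusp_level z \<le> 2 ^ m" using IH by (intro power_increasing) auto
    also have "m * 2 ^ m + 2 ^ m \<le> Suc m * 2 ^ Suc m" by simp
    finally show ?case using IH cusp_edge_bound[OF z(2)] V by simp
  qed (use assms in simp)
  from this[OF X.gdist_relpow, of "Base h"] show ?thesis using assms by simp
qed

text \<open>Replaces the base point \<open>x0\<close> by the identity vertex. For \<open>v0\<close>
  supporting \<open>x0\<close>, its translate by \<open>h\<close> lies over
  \<open>h \<otimes> g\<close> at the level of \<open>v0\<close>, hence at bounded distance from
  \<open>Base h\<close>. The realization assumptions come with any quasi-isometric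
  embedding.\<close>

lemma orbit_near_Base:
  assumes x0: "x0 \<in> realization X"
  obtains c where "\<And>h h'. \<lbrakk>h \<in> carrier G; h' \<in> carrier G; orbit_map G x0 h \<in> realization X;
      orbit_map G x0 h' \<in> realization X\<rbrakk> \<Longrightarrow>
    rdist X (orbit_map G x0 h) (orbit_map G x0 h') \<le> real (X.d (Base h) (Base h')) + c"
proof -
  obtain v0 where v0: "v0 \<in> spt x0" using X.realization_spt(2)[OF x0] by blast
  have V0: "v0 \<in> verts X" using v0 X.realization_spt(3)[OF x0] by blast
  define g where "g = cusp_base v0"
  have g: "g \<in> carrier G" unfolding g_def by (rule verts_cusp_base[OF V0])
  obtain m where m: "\<And>C x. C \<in> lcosets (generate G S) \<Longrightarrow> x \<in> C \<Longrightarrow> gdist (cayley_graph G C S) x (x \<otimes> g) \<le> m"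
    using word_length[OF S_carrier(2), of g] g S_carrier(3) by auto
  define c where "c = m + cusp_level v0"
  have spt: "cusp_act G h v0 \<in> spt (orbit_map G x0 h)" for h
  proof -
    have "0 < x0 v0" using v0 X.realization_spt(4)[OF x0, of v0] by (simp add: spt_def order_less_le)
    \<comment> \<open>Coordinates are nonnegative, so nothing cancels even if several vertices had
      the same image.\<close>
    also have "x0 v0 \<le> (\<Sum>x | x \<in> spt x0 \<and> cusp_act G h x = cusp_act G h v0. x0 x)"
      using v0 X.realization_spt(1,4)[OF x0] by (intro member_le_sum) auto
    finally show ?thesis by (simp add: orbit_map_def realization_map_def spt_def)
  qed
  have near: "X.d (Base h) (cusp_act G h v0) \<le> c"
    if h: "h \<in> carrier G" "orbit_map G x0 h \<in> realization X" for h
  proof -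
    have V: "cusp_act G h v0 \<in> verts X" using spt X.realization_spt(3)[OF h(2)] by blast
    have b: "cusp_base (cusp_act G h v0) = h \<otimes> g" "cusp_level (cusp_act G h v0) = cusp_level v0"
      unfolding g_def by (cases v0; simp)+
    have "X.d (Base h) (cusp_act G h v0) \<le> X.d (Base h) (Base (h \<otimes> g)) + X.d (Base (h \<otimes> g)) (cusp_act G h v0)"
      using V h g by (intro X.gdist_triangle) auto
    moreover have "X.d (Base h) (Base (h \<otimes> g)) \<le> m"
      using Base_lipschitz[of h "h \<otimes> g"] m[of "carrier G" h] h g S_carrier(3) carrier_lcoset by simp
    moreover have "X.d (Base (h \<otimes> g)) (cusp_act G h v0) \<le> cusp_level v0"
      using X.gdist_le[OF verts_cusp_path[OF V]] b by simp
    ultimately show ?thesis unfolding c_def by linarith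
  qed
  show thesis
  proof (rule that[of "2 * real c + 2"])
    fix h h' assume h: "h \<in> carrier G" "h' \<in> carrier G" "orbit_map G x0 h \<in> realization X"
      "orbit_map G x0 h' \<in> realization X"
    have V: "cusp_act G h v0 \<in> verts X" "cusp_act G h' v0 \<in> verts X"
      using spt X.realization_spt(3) h(3,4) by blast+
    have B: "Base h \<in> verts X" "Base h' \<in> verts X" using h by auto
    have "X.d (cusp_act G h v0) (cusp_act G h' v0) \<le> X.d (Base h) (Base h') + 2 * c"
      using X.gdist_triangle4[OF V(1) B V(2)] near[OF h(1,3)] near[OF h(2,4)] X.gdist_sym[OF B(1) V(1)]
      by linarith
    then show "rdist X (orbit_map G x0 h) (orbit_map G x0 h') \<le>
        real (X.d (Base h) (Base h')) + (2 * real c + 2)"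
      using X.rdist_gdist[OF h(3,4) spt spt] by linarith
  qed
qed

lemma relatively_hyperbolic_graph:
  assumes "relatively_hyperbolic G S n P"
  obtains \<delta> where "hyperbolic_graph X \<delta>"
proof -
  obtain \<delta> where \<delta>: "\<delta> \<ge> 0" and hyp: "\<And>w x y z. \<lbrakk>w \<in> realization X; x \<in> realization X;
      y \<in> realization X; z \<in> realization X\<rbrakk> \<Longrightarrow>
      gromov_product (rdist X) w x z \<ge>
        min (gromov_product (rdist X) w x y) (gromov_product (rdist X) w y z) - \<delta>"
    using assms unfolding relatively_hyperbolic_def Gromov_hyperbolic_def by blast
  have "hyperbolic_graph X \<delta>"
  proof
    fix w x y z assume "w \<in> verts X" "x \<in> verts X" "y \<in> verts X" "z \<in> verts X"
    then show "min (gromov_product X.d w x y) (gromov_product X.d w y z) - \<delta> \<le> gromov_product X.d w x z"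
      using hyp[OF X.indicator_realization X.indicator_realization X.indicator_realization
          X.indicator_realization, of w x y z]
      by (simp add: gromov_product_def rdist_vertices[OF X.sym_edges])
  qed (rule \<delta>)
  then show thesis by (rule that)
qed

end

section \<open>Stability\<close>

context connected_graph
begin

text \<open>Sampling at unit times and rounding to supporting vertices works without continuity. The
  ends are exact because the support of a vertex is a singleton.\<close>

lemma quasigeodesic_discretize:
  assumes \<gamma>: "quasigeodesic \<kappa> (realization \<Gamma>) (rdist \<Gamma>) s t \<gamma>"
    and ends: "\<gamma> s = indicator {a}" "\<gamma> t = indicator {b}"
  obtains N g \<tau> where "quasi_chain (\<kappa>\<^sup>2 + 2 * \<kappa> + 2) d N g" "g 0 = a" "g N = b"
    "\<And>i. i \<le> N \<Longrightarrow> g i \<in> verts \<Gamma>" "\<And>i. i \<le> N \<Longrightarrow> \<tau> i \<in> {s..t}" "\<And>i. i \<le> N \<Longrightarrow> g i \<in> spt (\<gamma> (\<tau> i))"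
    "\<And>x. x \<in> {s..t} \<Longrightarrow> \<exists>i\<le>N. \<bar>x - \<tau> i\<bar> \<le> 1"
proof -
  have st: "s \<le> t" and \<kappa>: "1 \<le> \<kappa>" and R: "\<And>x. x \<in> {s..t} \<Longrightarrow> \<gamma> x \<in> realization \<Gamma>"
    and qi: "\<And>x y. x \<in> {s..t} \<Longrightarrow> y \<in> {s..t} \<Longrightarrow>
      (1 / \<kappa>) * dist x y - \<kappa> \<le> rdist \<Gamma> (\<gamma> x) (\<gamma> y) \<and> rdist \<Gamma> (\<gamma> x) (\<gamma> y) \<le> \<kappa> * dist x y + \<kappa>"
    using \<gamma> unfolding quasigeodesic_def qi_embedding_const_def by auto
  define N where "N = nat \<lceil>t - s\<rceil>"
  \<comment> \<open>Truncation at \<open>t\<close> makes the last step possibly shorter than 1,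
    which costs the 1 in \<open>dist_ge\<close>.\<close>
  define \<tau> where "\<tau> = (\<lambda>i::nat. min (s + real i) t)"
  define g where "g = (\<lambda>i. SOME v. v \<in> spt (\<gamma> (\<tau> i)))"
  have N: "t \<le> s + real N" "s + real N < t + 1" using st unfolding N_def by linarith+
  have \<tau>: "\<tau> i \<in> {s..t}" for i using st by (auto simp: \<tau>_def)
  have g: "g i \<in> spt (\<gamma> (\<tau> i))" for i
    unfolding g_def some_in_eq by (rule realization_spt(2)[OF R[OF \<tau>]])
  have "\<tau> 0 = s" "\<tau> N = t" using st N by (auto simp: \<tau>_def)
  with ends g[of 0] g[of N] have g_ends: "g 0 = a" "g N = b" by auto
  have V: "g i \<in> verts \<Gamma>" for i using g realization_spt(3)[OF R[OF \<tau>]] by blast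
  have "quasi_chain (\<kappa>\<^sup>2 + 2 * \<kappa> + 2) d N g"
    unfolding quasi_chain_def
  proof (intro allI impI)
    fix i j assume ij: "i \<le> N" "j \<le> N"
    have close: "\<bar>rdist \<Gamma> (\<gamma> (\<tau> i)) (\<gamma> (\<tau> j)) - real (d (g i) (g j))\<bar> \<le> 2"
      by (intro rdist_gdist R \<tau> g)
    have dist_le: "dist (\<tau> i) (\<tau> j) \<le> \<bar>real i - real j\<bar>"
      unfolding \<tau>_def dist_real_def by linarith
    have "s + real l - 1 \<le> \<tau> l \<and> \<tau> l \<le> s + real l" if "l \<le> N" for l
    proof -
      have "real l \<le> real N" using that by simp
      then show ?thesis using N unfolding \<tau>_def by linarith
    qed
    from this[OF ij(1)] this[OF ij(2)] have dist_ge: "\<bar>real i - real j\<bar> \<le> dist (\<tau> i) (\<tau> j) + 1"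
      unfolding dist_real_def by linarith
    have "dist (\<tau> i) (\<tau> j) \<le> \<kappa> * (rdist \<Gamma> (\<gamma> (\<tau> i)) (\<gamma> (\<tau> j)) + \<kappa>)"
      using qi[OF \<tau> \<tau>, of i j] \<kappa> by (simp add: field_simps)
    also have "\<dots> \<le> \<kappa> * (real (d (g i) (g j)) + 2 + \<kappa>)"
      using close \<kappa> by (intro mult_left_mono) auto
    finally have 1: "\<bar>real i - real j\<bar> \<le> \<kappa> * real (d (g i) (g j)) + (\<kappa>\<^sup>2 + 2 * \<kappa> + 1)"
      using dist_ge by (simp add: algebra_simps power2_eq_square)
    have K: "\<kappa> \<le> \<kappa>\<^sup>2 + 2 * \<kappa> + 2" using \<kappa> by simp
    have "\<kappa> * real (d (g i) (g j)) \<le> (\<kappa>\<^sup>2 + 2 * \<kappa> + 2) * real (d (g i) (g j))"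
      by (rule mult_right_mono[OF K]) simp
    moreover have "real (d (g i) (g j)) \<le> \<kappa> * \<bar>real i - real j\<bar> + \<kappa> + 2"
      using close qi[OF \<tau> \<tau>, of i j] dist_le mult_left_mono[OF dist_le, of \<kappa>] \<kappa> by linarith
    moreover have "\<kappa> * \<bar>real i - real j\<bar> \<le> (\<kappa>\<^sup>2 + 2 * \<kappa> + 2) * \<bar>real i - real j\<bar>"
      by (rule mult_right_mono[OF K]) simp
    moreover have "0 \<le> \<kappa>\<^sup>2" by simp
    ultimately show "\<bar>real i - real j\<bar> \<le> (\<kappa>\<^sup>2 + 2 * \<kappa> + 2) * real (d (g i) (g j)) + (\<kappa>\<^sup>2 + 2 * \<kappa> + 2) \<and>
        real (d (g i) (g j)) \<le> (\<kappa>\<^sup>2 + 2 * \<kappa> + 2) * \<bar>real i - real j\<bar> + (\<kappa>\<^sup>2 + 2 * \<kappa> + 2)"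
      using 1 \<kappa> by linarith
  qed
  moreover have "\<exists>i\<le>N. \<bar>x - \<tau> i\<bar> \<le> 1" if "x \<in> {s..t}" for x
  proof (intro exI conjI)
    have "s \<le> x" "x \<le> t" using that by auto
    then show "nat \<lfloor>x - s\<rfloor> \<le> N" unfolding N_def by linarith
    have "real (nat \<lfloor>x - s\<rfloor>) \<le> x - s" "x - s \<le> real (nat \<lfloor>x - s\<rfloor>) + 1"
      using \<open>s \<le> x\<close> by linarith+
    then show "\<bar>x - \<tau> (nat \<lfloor>x - s\<rfloor>)\<bar> \<le> 1" using \<open>x \<le> t\<close> unfolding \<tau>_def by linarith
  qed
  ultimately show thesis using that g_ends V \<tau> g by blast
qed

end

lemma qi_embeddingI:
  assumes "f ` A \<subseteq> B" "1 \<le> k" "0 \<le> c"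
    and lower: "\<And>x y. \<lbrakk>x \<in> A; y \<in> A\<rbrakk> \<Longrightarrow> dA x y \<le> k * dB (f x) (f y) + c"
    and upper: "\<And>x y. \<lbrakk>x \<in> A; y \<in> A\<rbrakk> \<Longrightarrow> dB (f x) (f y) \<le> k * dA x y + c"
  shows "qi_embedding A dA B dB f"
proof -
  have "(1 / k) * dA x y - c \<le> dB (f x) (f y)" if "x \<in> A" "y \<in> A" for x y
  proof -
    have "dA x y \<le> k * dB (f x) (f y) + k * c"
      using lower[OF that] mult_right_mono[OF assms(2,3)] by linarith
    then show ?thesis using assms(2) by (simp add: field_simps)
  qed
  then show ?thesis unfolding qi_embedding_def qi_embedding_const_def using assms by blast
qed

context cusped_group
begin

text \<open>Both quasigeodesics are compared with one geodesic of \<open>H\<close>. Only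
  \<open>lower\<close> has to be assumed about the orbit, as the maps from \<open>H\<close> to the
  group and on to the cusped space are Lipschitz.\<close>

theorem quasigeodesics_hausdorff_close:
  assumes hyp: "relatively_hyperbolic G S n P" and H: "subgroup H G" and T: "finitely_generates G T H"
    and A: "finitely_generates G A (carrier G)" and K0: "0 \<le> K0"
    and lower: "\<And>h h'. \<lbrakk>h \<in> H; h' \<in> H\<rbrakk> \<Longrightarrow>
      real (gdist (cayley_graph G H T) h h') \<le> K0 * real (X.d (Base h) (Base h')) + K0"
    and \<kappa>: "1 \<le> \<kappa>"
  defines "\<Delta> \<equiv> cayley_graph G (carrier G) A"
  shows "\<exists>D>0. \<forall>a\<in>H. \<forall>b\<in>H. \<forall>\<gamma> s t \<gamma>' s' t'.
    quasigeodesic \<kappa> (realization \<Delta>) (rdist \<Delta>) s t \<gamma> \<longrightarrow> \<gamma> s = indicator {a} \<longrightarrow> \<gamma> t = indicator {b} \<longrightarrow>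
    quasigeodesic \<kappa> (realization \<Delta>) (rdist \<Delta>) s' t' \<gamma>' \<longrightarrow> \<gamma>' s' = indicator {a} \<longrightarrow> \<gamma>' t' = indicator {b} \<longrightarrow>
    hausdorff_close D (rdist \<Delta>) (\<gamma> ` {s..t}) (\<gamma>' ` {s'..t'})"
proof -
  have A': "finite A" "A \<subseteq> carrier G" "generate G A = carrier G"
    using A by (auto simp: finitely_generates_def)
  have T': "finite T" "T \<subseteq> carrier G" "generate G T = H"
    using T by (auto simp: finitely_generates_def)
  have HG: "H \<subseteq> carrier G" using H by (rule subgroup.subset)
  have HH: "H \<in> lcosets H" using H by (rule subgroup_in_lcosets)
  obtain \<delta> where "hyperbolic_graph X \<delta>" using relatively_hyperbolic_graph[OF hyp] .
  then interpret XH: hyperbolic_graph X \<delta> .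
  interpret \<Delta>: connected_graph \<Delta>
    unfolding \<Delta>_def using A' carrier_lcoset by (intro connected_cayley_graph) auto
  interpret HT: connected_graph "cayley_graph G H T"
    using T' HH by (intro connected_cayley_graph) auto
  have \<Delta>V: "verts \<Delta> = carrier G" by (simp add: \<Delta>_def)
  obtain M1 where "\<And>C D x y. \<lbrakk>C \<in> lcosets (generate G S); D \<in> lcosets (generate G A); C \<subseteq> D; x \<in> C; y \<in> C\<rbrakk>
    \<Longrightarrow> gdist (cayley_graph G D A) x y \<le> M1 * gdist (cayley_graph G C S) x y"
    by (rule cayley_lipschitz[of S A]) (use S_carrier A' in auto)
  then have M1: "\<Delta>.d x y \<le> M1 * Cay.d x y" if "x \<in> carrier G" "y \<in> carrier G" for x y
    unfolding \<Delta>_def using that S_carrier(3) A'(3) carrier_lcoset by auto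
  obtain M2 where "\<And>C D x y. \<lbrakk>C \<in> lcosets (generate G A); D \<in> lcosets (generate G S); C \<subseteq> D; x \<in> C; y \<in> C\<rbrakk>
    \<Longrightarrow> gdist (cayley_graph G D S) x y \<le> M2 * gdist (cayley_graph G C A) x y"
    by (rule cayley_lipschitz[of A S]) (use S_carrier A' in auto)
  then have "Cay.d x y \<le> M2 * \<Delta>.d x y" if "x \<in> carrier G" "y \<in> carrier G" for x y
    unfolding \<Delta>_def using that S_carrier(3) A'(3) carrier_lcoset by auto
  then have M2: "X.d (Base x) (Base y) \<le> M2 * \<Delta>.d x y" if "x \<in> carrier G" "y \<in> carrier G" for x y
    using that Base_lipschitz[OF that] order_trans by blast
  obtain M3 where "\<And>C D x y. \<lbrakk>C \<in> lcosets (generate G T); D \<in> lcosets (generate G A); C \<subseteq> D; x \<in> C; y \<in> C\<rbrakk>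
    \<Longrightarrow> gdist (cayley_graph G D A) x y \<le> M3 * gdist (cayley_graph G C T) x y"
    by (rule cayley_lipschitz[of T A]) (use T' A' in auto)
  then have M3: "\<Delta>.d x y \<le> M3 * HT.d x y" if "x \<in> H" "y \<in> H" for x y
    unfolding \<Delta>_def using that T'(3) A'(3) carrier_lcoset HH HG by auto
  define c where "c = \<kappa>\<^sup>2 + 2 * \<kappa> + 2"
  \<comment> \<open>A sum of nonnegative terms dominates each of them, so one constant serves all
    comparisons.\<close>
  define K where "K = K0 + real M2 + real M3 + real M2 * real M3 + K0 * real M2 + c"
  have c: "1 \<le> c" using \<kappa> by (simp add: c_def)
  have K: "1 \<le> K" "c \<le> K" "K0 \<le> K" "real M2 \<le> K" "real M3 \<le> K" "real (M2 * M3) \<le> K" "K0 * real M2 \<le> K"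
    using c K0 mult_nonneg_nonneg[OF K0, of "real M2"] mult_nonneg_nonneg[of "real M2" "real M3"]
    unfolding K_def of_nat_mult by linarith+
  have le_K: "x \<le> K * real y + K" if "x \<le> u * real y + v" "u \<le> K" "v \<le> K" for x u v y
    using that mult_right_mono[OF that(2), of "real y"] by simp
  have lip: "real (X.d (Base x) (Base y)) \<le> K * real (\<Delta>.d x y) + K"
    if "x \<in> verts \<Delta>" "y \<in> verts \<Delta>" for x y
    using M2[of x y] that K(1,4) le_K[of _ "real M2" _ 0] unfolding \<Delta>V
    by (simp flip: of_nat_mult)
  have chain_bounds: "real (HT.d x y) \<le> K * real (X.d (Base x) (Base y)) + K"
    "real (X.d (Base x) (Base y)) \<le> K * real (HT.d x y) + K"
    "real (HT.d x y) \<le> K * real (\<Delta>.d x y) + K"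
    "real (\<Delta>.d x y) \<le> K * real (HT.d x y) + K" if "x \<in> H" "y \<in> H" for x y
  proof -
    have xy: "x \<in> carrier G" "y \<in> carrier G" using that HG by auto
    show "real (HT.d x y) \<le> K * real (X.d (Base x) (Base y)) + K"
      by (rule le_K[OF lower[OF that] K(3) K(3)])
    have "X.d (Base x) (Base y) \<le> M2 * (M3 * HT.d x y)"
      using M2[OF xy] mult_le_mono2[OF M3[OF that], of M2] by linarith
    from of_nat_mono[OF this] have "real (X.d (Base x) (Base y)) \<le> real (M2 * M3) * real (HT.d x y) + 0"
      by (simp add: mult.assoc)
    then show "real (X.d (Base x) (Base y)) \<le> K * real (HT.d x y) + K"
      by (rule le_K) (use K(1,6) in auto)
    have "real (HT.d x y) \<le> (K0 * real M2) * real (\<Delta>.d x y) + K0"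
      using lower[OF that] mult_left_mono[OF _ K0, of "real (X.d (Base x) (Base y))" "real M2 * real (\<Delta>.d x y)"]
        of_nat_mono[OF M2[OF xy], where ?'a = real] by (simp add: mult.assoc)
    then show "real (HT.d x y) \<le> K * real (\<Delta>.d x y) + K"
      by (rule le_K) (use K(3,7) in auto)
    have "real (\<Delta>.d x y) \<le> real M3 * real (HT.d x y) + 0"
      using M3[OF that] by (simp flip: of_nat_mult)
    then show "real (\<Delta>.d x y) \<le> K * real (HT.d x y) + K" by (rule le_K) (use K(1,5) in auto)
  qed
  \<comment> \<open>\<open>cusp_proper\<close> bounds the word length for \<open>S\<close>; the
    factor \<open>M1\<close> converts it to \<open>A\<close>.\<close>
  define F where "F = (\<lambda>r. M1 * (r * 2 ^ r))"
  have F: "mono F" unfolding F_def by (intro monoI mult_le_mono power_increasing) auto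
  have proper: "\<Delta>.d x y \<le> F (X.d (Base x) (Base y))" if "x \<in> verts \<Delta>" "y \<in> verts \<Delta>" for x y
    using M1[of x y] mult_le_mono2[OF cusp_proper[of x y], of M1] that unfolding \<Delta>V F_def by linarith
  obtain D1 where D1: "\<And>m h N g k. \<lbrakk>\<And>i. i \<le> m \<Longrightarrow> h i \<in> verts \<Delta>; quasi_chain K X.d m (\<lambda>i. Base (h i));
      quasi_chain K \<Delta>.d m h; \<And>i. i \<le> N \<Longrightarrow> g i \<in> verts \<Delta>; quasi_chain K \<Delta>.d N g;
      g 0 = h 0; g N = h m; k \<le> N\<rbrakk> \<Longrightarrow> \<exists>j\<le>m. real (\<Delta>.d (g k) (h j)) \<le> D1"
    by (rule XH.quasi_chain_near[OF \<Delta>.connected_graph_axioms _ K(1) lip proper F]) (auto simp: \<Delta>V)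
  \<comment> \<open>The bound of \<open>quasi_chain_dense\<close> for jumps of size
    \<open>2 * K\<close>.\<close>
  define D2 where "D2 = K * (K * (2 * D1 + 2 * K) + K) + K + D1"
  \<comment> \<open>From a vertex of \<open>x\<close> to \<open>g i\<close> at most
    \<open>2 * \<kappa> + 2\<close>, on to \<open>h j\<close> and \<open>g' k\<close> by
    \<open>D1\<close> and \<open>D2\<close>, and 2 for returning to the realization.\<close>
  define D where "D = max 1 (2 * \<kappa> + 4 + D1 + D2)"
  \<comment> \<open>One inclusion suffices; exchanging the two quasigeodesics gives the
    other.\<close>
  have half: "\<exists>y\<in>\<gamma>' ` {s'..t'}. rdist \<Delta> x y \<le> D"
    if ab: "a \<in> H" "b \<in> H"
      and \<gamma>: "quasigeodesic \<kappa> (realization \<Delta>) (rdist \<Delta>) s t \<gamma>" "\<gamma> s = indicator {a}" "\<gamma> t = indicator {b}"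
      and \<gamma>': "quasigeodesic \<kappa> (realization \<Delta>) (rdist \<Delta>) s' t' \<gamma>'" "\<gamma>' s' = indicator {a}" "\<gamma>' t' = indicator {b}"
      and x: "x \<in> \<gamma> ` {s..t}"
    for a b \<gamma> s t \<gamma>' s' t' x
  proof -
    define m where "m = HT.d a b"
    obtain h where h: "HT.geodesic h m" "h 0 = a" "h m = b"
      unfolding m_def by (rule HT.geodesic_exists[of a b]) (use ab in auto)
    have hH: "h i \<in> H" if "i \<le> m" for i using h(1) that unfolding HT.geodesic_def by simp
    have h\<Delta>V: "h i \<in> verts \<Delta>" if "i \<le> m" for i using hH[OF that] HG by (auto simp: \<Delta>V)
    have hX: "quasi_chain K X.d m (\<lambda>i. Base (h i))"
      using chain_bounds by (intro HT.quasi_chain_geodesic[OF h(1)]) auto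
    have h\<Delta>: "quasi_chain K \<Delta>.d m (\<lambda>i. h i)"
      using chain_bounds by (intro HT.quasi_chain_geodesic[OF h(1), where \<phi> = "\<lambda>x. x"]) auto
    obtain N g \<tau> where g: "quasi_chain c \<Delta>.d N g" "g 0 = a" "g N = b" "\<And>i. i \<le> N \<Longrightarrow> g i \<in> verts \<Delta>"
      and \<tau>: "\<And>i. i \<le> N \<Longrightarrow> \<tau> i \<in> {s..t}" "\<And>i. i \<le> N \<Longrightarrow> g i \<in> spt (\<gamma> (\<tau> i))"
        "\<And>x. x \<in> {s..t} \<Longrightarrow> \<exists>i\<le>N. \<bar>x - \<tau> i\<bar> \<le> 1"
      by (rule \<Delta>.quasigeodesic_discretize[OF \<gamma>, folded c_def]) (rule that)
    obtain N' g' \<tau>' where g': "quasi_chain c \<Delta>.d N' g'" "g' 0 = a" "g' N' = b"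
        "\<And>i. i \<le> N' \<Longrightarrow> g' i \<in> verts \<Delta>"
      and \<tau>': "\<And>i. i \<le> N' \<Longrightarrow> \<tau>' i \<in> {s'..t'}" "\<And>i. i \<le> N' \<Longrightarrow> g' i \<in> spt (\<gamma>' (\<tau>' i))"
      by (rule \<Delta>.quasigeodesic_discretize[OF \<gamma>', folded c_def]) (rule that)
    note gK = quasi_chain_mono[OF g(1) K(2)] and gK' = quasi_chain_mono[OF g'(1) K(2)]
    obtain u where u: "u \<in> {s..t}" "x = \<gamma> u" using x by blast
    obtain i where i: "i \<le> N" "\<bar>u - \<tau> i\<bar> \<le> 1" using \<tau>(3)[OF u(1)] by blast
    obtain j where j: "j \<le> m" "real (\<Delta>.d (g i) (h j)) \<le> D1"
      using D1[OF h\<Delta>V hX h\<Delta> g(4) gK _ _ i(1)] g(2,3) h(2,3) by auto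
    have near': "\<exists>j\<le>m. real (\<Delta>.d (g' k) (h j)) \<le> D1" if "k \<le> N'" for k
      using D1[OF h\<Delta>V hX h\<Delta> g'(4) gK' _ _ that] g'(2,3) h(2,3) by auto
    have step': "real (\<Delta>.d (g' k) (g' (Suc k))) \<le> 2 * K" if "k < N'" for k
    proof -
      have "k \<le> N'" "Suc k \<le> N'" using that by auto
      then have "real (\<Delta>.d (g' k) (g' (Suc k))) \<le> K * \<bar>real k - real (Suc k)\<bar> + K"
        using gK' unfolding quasi_chain_def by blast
      then show ?thesis by simp
    qed
    have "\<exists>k\<le>N'. real (\<Delta>.d (h j) (g' k)) \<le> D2"
      unfolding D2_def
    proof (rule \<Delta>.quasi_chain_dense[OF h\<Delta>])
      show "0 \<le> K" "0 \<le> 2 * K" using K(1) by auto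
      show "g' 0 = h 0" "g' N' = h m" using g'(2,3) h(2,3) by auto
    qed (use h\<Delta>V g'(4) step' near' j(1) in auto)
    then obtain k where k: "k \<le> N'" "real (\<Delta>.d (h j) (g' k)) \<le> D2" by blast
    have R: "x \<in> realization \<Delta>" "\<gamma> (\<tau> i) \<in> realization \<Delta>" "\<gamma>' (\<tau>' k) \<in> realization \<Delta>"
      using \<gamma>(1) \<gamma>'(1) u \<tau>(1)[OF i(1)] \<tau>'(1)[OF k(1)]
      unfolding quasigeodesic_def qi_embedding_const_def by auto
    obtain v where v: "v \<in> spt x" using \<Delta>.realization_spt(2)[OF R(1)] by blast
    have "rdist \<Delta> x (\<gamma> (\<tau> i)) \<le> \<kappa> * dist u (\<tau> i) + \<kappa>"
      using \<gamma>(1) u \<tau>(1)[OF i(1)] unfolding quasigeodesic_def qi_embedding_const_def by blast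
    also have "\<dots> \<le> \<kappa> * 1 + \<kappa>"
      using i(2) \<kappa> by (intro add_mono mult_left_mono) (auto simp: dist_real_def)
    finally have "real (\<Delta>.d v (g i)) \<le> 2 * \<kappa> + 2"
      using \<Delta>.rdist_gdist[OF R(1,2) v \<tau>(2)[OF i(1)]] by linarith
    moreover have "v \<in> verts \<Delta>" using v \<Delta>.realization_spt(3)[OF R(1)] by blast
    then have "\<Delta>.d v (g' k) \<le> \<Delta>.d v (g i) + \<Delta>.d (g i) (h j) + \<Delta>.d (h j) (g' k)"
      using g(4)[OF i(1)] h\<Delta>V[OF j(1)] g'(4)[OF k(1)] by (rule \<Delta>.gdist_triangle4)
    ultimately have "rdist \<Delta> x (\<gamma>' (\<tau>' k)) \<le> D"
      using \<Delta>.rdist_gdist[OF R(1,3) v \<tau>'(2)[OF k(1)]] j(2) k(2) unfolding D_def by linarith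
    then show ?thesis using \<tau>'(1)[OF k(1)] by blast
  qed
  have "0 < D" by (simp add: D_def)
  then show ?thesis unfolding hausdorff_close_def by (intro exI[of _ D]) (blast intro: half)
qed

end

theorem theorem1p4:
  fixes G :: "('a, 'm) monoid_scheme"
    and S H T :: "'a set"
    and n :: nat
    and P :: "nat \<Rightarrow> 'a set"
    and x0 :: "'a cusp_vertex \<Rightarrow> real"
  assumes "group G"
    and "finitely_generates G S (carrier G)"
    and "\<And>i. i \<in> {1..n} \<Longrightarrow> subgroup (P i) G"
    and "\<And>i. i \<in> {1..n} \<Longrightarrow> generate G (S \<inter> P i) = P i"
    and "relatively_hyperbolic G S n P"
    and "subgroup H G"
    and "finitely_generates G T H"
    and "x0 \<in> realization (cusp G S n P)"
    and "qi_embedding H (word_metric G H T)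
           (realization (cusp G S n P)) (rdist (cusp G S n P)) (orbit_map G x0)"
  shows "stable_subgroup G H"
proof -
  interpret group G by fact
  interpret cusped_group G S n P
    by (intro cusped_group.intro cusped_group_axioms.intro assms)
  have H: "H \<subseteq> carrier G" "H \<in> lcosets\<^bsub>G\<^esub> H"
    using assms(6) by (auto intro: subgroup.subset subgroup_in_lcosets dest: subgroup.subset)
  obtain k c where kc: "qi_embedding_const k c H (word_metric G H T) (realization X) (rdist X) (orbit_map G x0)"
    using assms(9) unfolding qi_embedding_def by (elim exE)
  then have k: "1 \<le> k" "0 \<le> c" and orbit: "orbit_map G x0 ` H \<subseteq> realization X"
    unfolding qi_embedding_const_def by simp_all
  have qi: "(1 / k) * word_metric G H T h h' - c \<le> rdist X (orbit_map G x0 h) (orbit_map G x0 h')"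
    if "h \<in> H" "h' \<in> H" for h h'
    using kc that unfolding qi_embedding_const_def by simp
  obtain c' where c': "\<And>h h'. \<lbrakk>h \<in> carrier G; h' \<in> carrier G; orbit_map G x0 h \<in> realization X;
      orbit_map G x0 h' \<in> realization X\<rbrakk> \<Longrightarrow>
    rdist X (orbit_map G x0 h) (orbit_map G x0 h') \<le> real (X.d (Base h) (Base h')) + c'"
    by (rule orbit_near_Base[OF assms(8)]) (rule that)
  \<comment> \<open>Solving the lower quasi-isometry bound for the word metric gives slope
    \<open>k\<close> and constant \<open>k * (c + c')\<close>.\<close>
  define K0 where "K0 = max k (k * (c + c'))"
  have K0: "0 \<le> K0" using k by (simp add: K0_def)
  have lower: "real (gdist (cayley_graph G H T) h h') \<le> K0 * real (X.d (Base h) (Base h')) + K0"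
    if "h \<in> H" "h' \<in> H" for h h'
  proof -
    have "(1 / k) * word_metric G H T h h' - c \<le> real (X.d (Base h) (Base h')) + c'"
      using qi[OF that] c'[of h h'] that H(1) orbit by fastforce
    then have "word_metric G H T h h' \<le> k * real (X.d (Base h) (Base h')) + k * (c + c')"
      using k by (simp add: field_simps)
    also have "\<dots> \<le> K0 * real (X.d (Base h) (Base h')) + K0"
      unfolding K0_def by (intro add_mono mult_right_mono) auto
    finally show ?thesis by (simp add: word_metric_def)
  qed
  have T: "finite T" "T \<subseteq> carrier G" "generate G T = H"
    using assms(7) by (auto simp: finitely_generates_def)
  \<comment> \<open>The upper bound comes from writing generators as words. The lower one passes
    from \<open>T'\<close> to \<open>T\<close>, then by \<open>lower\<close> to the cusped space,
    whose distance is bounded by word length in \<open>S\<close> and so in \<open>A\<close>.\<close>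
  have "qi_embedding H (word_metric G H T') (carrier G) (word_metric G (carrier G) A) (\<lambda>h. h)"
    if "finitely_generates G T' H" "finitely_generates G A (carrier G)" for T' A
  proof -
    have T': "finite T'" "T' \<subseteq> carrier G" "generate G T' = H"
      and A: "finite A" "A \<subseteq> carrier G" "generate G A = carrier G"
      using that by (auto simp: finitely_generates_def)
    obtain M1 where "\<And>C D x y. \<lbrakk>C \<in> lcosets\<^bsub>G\<^esub> (generate G T); D \<in> lcosets\<^bsub>G\<^esub> (generate G T'); C \<subseteq> D;
      x \<in> C; y \<in> C\<rbrakk> \<Longrightarrow> gdist (cayley_graph G D T') x y \<le> M1 * gdist (cayley_graph G C T) x y"
      by (rule cayley_lipschitz[of T T']) (use T T' generate.incl[of _ T G] in auto)
    then have M1: "gdist (cayley_graph G H T') x y \<le> M1 * gdist (cayley_graph G H T) x y"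
      if "x \<in> H" "y \<in> H" for x y using that T(3) T'(3) H by auto
    obtain M2 where "\<And>C D x y. \<lbrakk>C \<in> lcosets\<^bsub>G\<^esub> (generate G A); D \<in> lcosets\<^bsub>G\<^esub> (generate G S); C \<subseteq> D;
      x \<in> C; y \<in> C\<rbrakk> \<Longrightarrow> gdist (cayley_graph G D S) x y \<le> M2 * gdist (cayley_graph G C A) x y"
      by (rule cayley_lipschitz[of A S]) (use S_carrier A in auto)
    then have M2: "Cay.d x y \<le> M2 * gdist (cayley_graph G (carrier G) A) x y"
      if "x \<in> carrier G" "y \<in> carrier G" for x y using that S_carrier(3) A(3) carrier_lcoset by auto
    obtain M3 where "\<And>C D x y. \<lbrakk>C \<in> lcosets\<^bsub>G\<^esub> (generate G T'); D \<in> lcosets\<^bsub>G\<^esub> (generate G A); C \<subseteq> D;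
      x \<in> C; y \<in> C\<rbrakk> \<Longrightarrow> gdist (cayley_graph G D A) x y \<le> M3 * gdist (cayley_graph G C T') x y"
      by (rule cayley_lipschitz[of T' A]) (use T' A in auto)
    then have M3: "gdist (cayley_graph G (carrier G) A) x y \<le> M3 * gdist (cayley_graph G H T') x y"
      if "x \<in> H" "y \<in> H" for x y using that T'(3) A(3) carrier_lcoset H by auto
    define K where "K = max 1 (max (real M3) (real M1 * K0 * real M2))"
    show ?thesis
    proof (rule qi_embeddingI)
      show "(\<lambda>h. h) ` H \<subseteq> carrier G" using H by auto
      show "1 \<le> K" "0 \<le> real M1 * K0" using K0 by (auto simp: K_def)
      fix x y assume xy: "x \<in> H" "y \<in> H"
      then have xyG: "x \<in> carrier G" "y \<in> carrier G" using H by auto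
      let ?dA = "word_metric G (carrier G) A x y" and ?dT = "word_metric G H T' x y"
      have nonneg: "0 \<le> ?dA" "0 \<le> ?dT" by (auto simp: word_metric_def)
      have "?dT \<le> real M1 * real (gdist (cayley_graph G H T) x y)"
        using M1[OF xy] by (simp add: word_metric_def flip: of_nat_mult)
      also have "\<dots> \<le> real M1 * (K0 * real (X.d (Base x) (Base y)) + K0)"
        using lower[OF xy] by (intro mult_left_mono) auto
      also have "real (X.d (Base x) (Base y)) \<le> real M2 * ?dA"
        using M2[OF xyG] Base_lipschitz[OF xyG] by (simp add: word_metric_def flip: of_nat_mult)
      then have "real M1 * (K0 * real (X.d (Base x) (Base y)) + K0) \<le> real M1 * (K0 * (real M2 * ?dA) + K0)"
        using K0 by (intro mult_left_mono add_mono) auto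
      also have "\<dots> = (real M1 * K0 * real M2) * ?dA + real M1 * K0" by (simp add: algebra_simps)
      also have "\<dots> \<le> K * ?dA + real M1 * K0"
        using nonneg K0 by (intro add_mono mult_right_mono) (auto simp: K_def)
      finally show "?dT \<le> K * ?dA + real M1 * K0" .
      have "?dA \<le> real M3 * ?dT" using M3[OF xy] by (simp add: word_metric_def flip: of_nat_mult)
      also have "\<dots> \<le> K * ?dT" using nonneg by (intro mult_right_mono) (auto simp: K_def)
      finally show "?dA \<le> K * ?dT + real M1 * K0" using K0 by (simp add: add_increasing2)
    qed
  qed
  moreover have "\<exists>T. finitely_generates G T H" "\<exists>A. finitely_generates G A (carrier G)"
    using assms(2,7) by auto
  ultimately show ?thesis
    unfolding stable_subgroup_def Let_def
    using assms(6) quasigeodesics_hausdorff_close[OF assms(5-7) _ K0 lower]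
    by (simp add: less_imp_le)
qed

end
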